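(* Let $m=n$. Consider the nonlinear control system $\dot x=f(x,u,w(t))$, $t\ge 0$, with $f:\mathbb{R}^n\times\mathbb{R}^m\times\mathbb{R}^p\to\mathbb{R}^n$ as in the context, and the pair $(x_d(t),u_d(t))$, where $x_d(t)$, $t\ge 0$, is a desired state trajectory satisfying the system for the input $u=u_d(t)$. Put $A(t)=J_xf|_{(x,u)=(x_d(t),u_d(t))}$ and $B(t)=J_uf|_{(x,u)=(x_d(t),u_d(t))}$ (Jacobian matrices of $f(x,u,w(t))$ with respect to $x$ and $u$). Let for all $t\ge 0$: (A1) $|x_d(t)|\le\gamma_{x_d}$, $|u_d(t)|\le\gamma_{u_d}$ and $|w(t)|\le\gamma_w$ for some nonnegative constants $\gamma_{x_d}$, $\gamma_{u_d}$ and $\gamma_w$; (A2) the rank of the matrix $B(t)$ is equal to $n$; (A3) $\|B^{-1}(t)\|_F\le\beta_1\exp[\lambda_* t]$ for some constants $\beta_1>0$ and $\lambda_*\ge 0$, $$\left(\|B^{-1}(t)\|_F\le\beta_1\exp[\lambda_* t]\Longleftrightarrow\|B(t)\|_F\ge\frac{\sqrt n}{\beta_1}\exp[-\lambda_* t]\right);$$ (A4) $\|B^{-1}(t)A(t)\|_F\le\beta_2\exp[\lambda_* t]$ for some constant $\beta_2\ge 0$; (A5) there exist constants $\alpha>0$, $\beta_3\ge 0$ and $\kappa>0$ such that $|r(e,0,w(t))|\le\beta_3|e|^\alpha$ for $|e|\le\kappa$, where $$r(e,0,w(t))=f(e+x_d,u_d,w(t))-f(x_d,u_d,w(t))-A(t)e.$$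 Then there exists a control law $u^*=u_d(t)+v^*(x-x_d,w(t))$, of class $C^k$ in the variable $x-x_d$, which makes the desired trajectory $x_d(t)$ of the system locally asymptotically (exponentially) stable, that is, $e(t)=x(t)-x_d(t)\to 0$ for $t\to\infty$ and $x(0)$ satisfying $|x(0)-x_d(0)|<\delta$ for some $\delta>0$. More concretely, for an arbitrary semi-simple Hurwitz matrix $\Delta$ (of dimension $n$) in Jordan canonical form with the eigenvalues $\lambda_i$, $i=1,\dots,n$, satisfying $$2\max\left\{\frac{\lambda_*}{\alpha},\lambda_*\right\}+\max_{i=1,\dots,n}\{\mathrm{Re}\,\lambda_i\}<0$$ we have $$x(t)-x_d(t)=\exp[\Delta t]\,(x(0)-x_d(0))\quad\text{for } t\ge 0.$$
   Context: Standing assumptions: in $\dot x=f(x,u,w(t))$, $x\in\mathbb{R}^n$ is the state, $u\in\mathbb{R}^m$ is the control input (here $m=n$), and $w(t)\in\mathbb{R}^p$ represents bounded, measurable disturbance inputs that cannot be influenced by control. The function $f$ is $C^k$ ($k\ge 2$) in the variables $(x,u)\in\mathbb{R}^n\times\mathbb{R}^m$ and continuous on $\mathbb{R}^n\times\mathbb{R}^m\times\mathbb{R}^p$, and for every initial state $x(0)$ and input $u$ there exists a unique solution defined on $[0,\infty)$. Notation: $|\cdot|$ is the Euclidean norm; $\|\cdot\|_F$ is the Frobenius matrix norm (or another norm that is submultiplicative and compatible with a vector norm). A Hurwitz matrix is one all of whose eigenvalues have negative real part; semi-simple means that the algebraic and geometric multiplicities of each eigenvalue coincide. For simplicity, the matrices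 $\Delta$ are restricted to those with real eigenvalues. In the conclusion, $x(t)$ is the solution of the closed-loop system $\dot x=f(x,u^*,w(t))$.
   Formalization: "C^k in (x,u)" is taken to mean that all (x,u)-derivatives of f up to order k are jointly continuous in (x,u,w), and v* may depend also on x_d(t) and u_d(t); without these the claim fails. The false equivalence in parentheses in (A3) is dropped. *)

theory Defs
  imports "HOL-Analysis.Analysis" "HOL-Computational_Algebra.Polynomial"
begin

subsection \<open>Functions of class \<open>C\<^sup>k\<close>\<close>

text \<open>
  \<open>C\<^sup>k\<close> is defined by recursion on \<open>k\<close> through all directional derivatives, which keeps the
  type of the differentiated function fixed.
\<close>

primrec C_k :: "nat \<Rightarrow> ('a::real_normed_vector \<Rightarrow> 'b::real_normed_vector) \<Rightarrow> bool" where
  "C_k 0 g \<longleftrightarrow> continuous_on UNIV g"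
| "C_k (Suc k) g \<longleftrightarrow>
     (\<forall>z. g differentiable (at z)) \<and>
     (\<forall>h. C_k k (\<lambda>z. frechet_derivative g (at z) h))"

text \<open>
  \<open>C\<^sup>k\<close> in the first argument, with a parameter as second argument: all derivatives of order at
  most \<open>k\<close> with respect to the first argument exist and are jointly continuous in both arguments.
\<close>

primrec C_k_param ::
  "nat \<Rightarrow> ('a::real_normed_vector \<Rightarrow> 'p::topological_space \<Rightarrow> 'b::real_normed_vector) \<Rightarrow> bool"
where
  "C_k_param 0 g \<longleftrightarrow> continuous_on UNIV (\<lambda>(z, q). g z q)"
| "C_k_param (Suc k) g \<longleftrightarrow>
     continuous_on UNIV (\<lambda>(z, q). g z q) \<and>
     (\<forall>q z. (\<lambda>z. g z q) differentiable (at z)) \<and>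
     (\<forall>h. C_k_param k (\<lambda>z q. frechet_derivative (\<lambda>z. g z q) (at z) h))"

subsection \<open>Matrices\<close>

definition frobenius_norm :: "real^'n^'m \<Rightarrow> real" where
  "frobenius_norm M = sqrt (\<Sum>i\<in>UNIV. \<Sum>j\<in>UNIV. (M $ i $ j)\<^sup>2)"

text \<open>
  The multiplication available on \<^typ>\<open>real^'n^'n\<close> as a type class operation is componentwise, so
  \<^const>\<open>exp\<close> and \<^const>\<open>power\<close> cannot be used for matrices.
\<close>

definition matrix_exp :: "real^'n^'n \<Rightarrow> real^'n^'n" where
  "matrix_exp M = (\<Sum>k. (((**) M ^^ k) (mat 1)) /\<^sub>R fact k)"

definition complex_matrix :: "real^'n^'n \<Rightarrow> complex^'n^'n" where
  "complex_matrix M = (\<chi> i j. complex_of_real (M $ i $ j))"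

definition eigenvalues :: "complex^'n^'n \<Rightarrow> complex set" where
  "eigenvalues M = {l. \<exists>v. v \<noteq> 0 \<and> M *v v = l *s v}"

definition characteristic_poly :: "complex^'n^'n \<Rightarrow> complex poly" where
  "characteristic_poly M = det (\<chi> i j. (if i = j then [:0, 1:] else 0) - [:M $ i $ j:])"

definition algebraic_multiplicity :: "complex^'n^'n \<Rightarrow> complex \<Rightarrow> nat" where
  "algebraic_multiplicity M l = order l (characteristic_poly M)"

definition geometric_multiplicity :: "complex^'n^'n \<Rightarrow> complex \<Rightarrow> nat" where
  "geometric_multiplicity M l = vec.dim {v. M *v v = l *s v}"

definition semi_simple :: "complex^'n^'n \<Rightarrow> bool" where
  "semi_simple M \<longleftrightarrow>
     (\<forall>l\<in>eigenvalues M. algebraic_multiplicity M l = geometric_multiplicity M l)"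

definition hurwitz :: "complex^'n^'n \<Rightarrow> bool" where
  "hurwitz M \<longleftrightarrow> (\<forall>l\<in>eigenvalues M. Re l < 0)"

text \<open>
  The index type carries no order, so \<open>h\<close> enumerates the coordinates: in this enumeration, the
  nonzero entries lie on the diagonal and on the first superdiagonal, and a superdiagonal entry is
  \<open>1\<close> inside a block, where the diagonal entry is constant, and \<open>0\<close> between two blocks.
\<close>

definition jordan_canonical_form :: "real^'n^'n \<Rightarrow> bool" where
  "jordan_canonical_form M \<longleftrightarrow>
     (\<exists>h. bij_betw h {..<CARD('n)} (UNIV :: 'n set) \<and>
       (\<forall>i<CARD('n). \<forall>j<CARD('n).
          (j \<noteq> i \<and> j \<noteq> Suc i \<longrightarrow> M $ h i $ h j = 0) \<and>
          (j = Suc i \<longrightarrow>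
             M $ h i $ h j = 0 \<or> (M $ h i $ h j = 1 \<and> M $ h i $ h i = M $ h j $ h j))))"

subsection \<open>Control systems\<close>

text \<open>
  Inputs and disturbances are only measurable in time, so solutions on \<open>[0, \<infinity>)\<close> are understood in
  the sense of Caratheodory: \<open>x\<close> is locally absolutely continuous and satisfies the differential
  equation almost everywhere, i.e. \<open>x\<close> satisfies the integral equation. Functions of time are total
  on \<^typ>\<open>real\<close>; their values at negative times are irrelevant.
\<close>

definition is_solution ::
  "(real^'n \<Rightarrow> real^'m \<Rightarrow> real^'p \<Rightarrow> real^'n) \<Rightarrow> (real \<Rightarrow> real^'m) \<Rightarrow> (real \<Rightarrow> real^'p)
     \<Rightarrow> (real \<Rightarrow> real^'n) \<Rightarrow> bool"
where
  "is_solution f u w x \<longleftrightarrow>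
     (\<forall>t\<ge>0. (\<lambda>s. f (x s) (u s) (w s)) absolutely_integrable_on {0..t} \<and>
            x t = x 0 + integral {0..t} (\<lambda>s. f (x s) (u s) (w s)))"

definition admissible_input :: "(real \<Rightarrow> real^'m) \<Rightarrow> bool" where
  "admissible_input u \<longleftrightarrow>
     u \<in> borel_measurable (lebesgue_on {0..}) \<and> (\<forall>T\<ge>0. bounded (u ` {0..T}))"

definition unique_solution_from :: "((real \<Rightarrow> real^'n) \<Rightarrow> bool) \<Rightarrow> real^'n \<Rightarrow> bool" where
  "unique_solution_from sol x0 \<longleftrightarrow>
     (\<exists>x. sol x \<and> x 0 = x0) \<and>
     (\<forall>x y. sol x \<and> sol y \<and> x 0 = x0 \<and> y 0 = x0 \<longrightarrow> (\<forall>t\<ge>0. x t = y t))"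

text \<open>
  The feedback \<open>u\<^sub>d(t) + v(x - x\<^sub>d(t), w(t))\<close>. The correction \<open>v\<close> depends on the reference point
  \<open>(x\<^sub>d(t), u\<^sub>d(t))\<close> as well, as the remainder \<open>r\<close> does; this dependence is made explicit in the
  first two arguments of \<open>v\<close>.
\<close>

definition closed_loop_solution ::
  "(real^'n \<Rightarrow> real^'m \<Rightarrow> real^'p \<Rightarrow> real^'n) \<Rightarrow> (real \<Rightarrow> real^'n) \<Rightarrow> (real \<Rightarrow> real^'m)
     \<Rightarrow> (real \<Rightarrow> real^'p) \<Rightarrow> (real^'n \<Rightarrow> real^'m \<Rightarrow> real^'n \<Rightarrow> real^'p \<Rightarrow> real^'m)
     \<Rightarrow> (real \<Rightarrow> real^'n) \<Rightarrow> bool"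
where
  "closed_loop_solution f xd ud w v x \<longleftrightarrow>
     is_solution f (\<lambda>t. ud t + v (xd t) (ud t) (x t - xd t) (w t)) w x"

text \<open>
  \<open>xd\<close> is exponentially stable for the dynamics with solutions \<open>sol\<close>, with basin of attraction
  containing the ball of radius \<open>\<delta>\<close>.
\<close>

definition exponentially_stable_within ::
  "((real \<Rightarrow> real^'n) \<Rightarrow> bool) \<Rightarrow> (real \<Rightarrow> real^'n) \<Rightarrow> real \<Rightarrow> bool"
where
  "exponentially_stable_within sol xd \<delta> \<longleftrightarrow>
     (\<forall>x0. norm (x0 - xd 0) < \<delta> \<longrightarrow> unique_solution_from sol x0) \<and>
     (\<forall>x. sol x \<and> norm (x 0 - xd 0) < \<delta> \<longrightarrow> ((\<lambda>t. x t - xd t) \<longlongrightarrow> 0) at_top) \<and>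
     (\<exists>M>0. \<exists>\<mu>>0. \<forall>x. sol x \<and> norm (x 0 - xd 0) < \<delta> \<longrightarrow>
        (\<forall>t\<ge>0. norm (x t - xd t) \<le> M * exp (- \<mu> * t) * norm (x 0 - xd 0)))"

end

(*
  Assumption A2 makes the input Jacobian B(t) invertible, so the equation
  f(xd + e, ud + v, w) = f(xd, ud, w) + Delta e can be solved for v near (e, v) = (0, 0): with this
  feedback the error satisfies the linear equation e' = Delta e exactly. A quantitative contraction
  argument, based on bounds for the first two derivatives of f on the compact set swept out by
  (xd, ud, w), shows that the solution v exists for |e| <= c / |B(t)^-1|^2, hence, by A3, for
  |e| <= c' exp(-2 nu t). Since the eigenvalues of Delta are smaller than -2 nu, the error decays
  faster than this radius shrinks and never leaves the region where the feedback is exact.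
*)
theory Submission
  imports Defs
begin

subsection \<open>Calculus of \<open>C\<^sup>k\<close> functions\<close>

text \<open>The implicit function theorem alone would give, at each time, a feedback on some
  neighbourhood, with no control of its size as the inverse input Jacobian grows. Hence a simplified
  Newton map with explicit radii. The square in \<open>c / M\<^sup>2\<close> has two sources: if
  \<open>M\<close> bounds the inverse Jacobian, the map contracts only for corrections of size about
  \<open>1 / M\<close>, and the correction for an error \<open>e\<close> may be a multiple of
  \<open>M * norm e\<close>. All other constants come from compactness and are independent of time,
  so the radius shrinks at rate \<open>2 * \<nu>\<close>; this is the factor 2 in the eigenvalue
  condition.

  Smoothness in \<open>e\<close> is global, but the feedback is chosen separately for each value of
  \<open>(xd, ud, w)\<close>, with no regularity in these variables. Integrability along the closed
  loop is still clear: on the relevant solutions the right-hand side equals that of the reference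
  plus \<open>\<Delta> *v e\<close>. Uniqueness likewise comes from exactness of the linear error
  equation: every solution starting close enough is given by the matrix exponential.\<close>

lemma C_k_SucI:
  assumes "\<And>z. (g has_derivative g' z) (at z)" and "\<And>h. C_k k (\<lambda>z. g' z h)"
  shows "C_k (Suc k) g"
proof -
  have "frechet_derivative g (at z) = g' z" for z
    using frechet_derivative_at[OF assms(1)] by simp
  then show ?thesis
    using assms unfolding C_k.simps differentiable_def by auto
qed

lemma C_k_Suc_has_derivative:
  "C_k (Suc k) g \<Longrightarrow> (g has_derivative frechet_derivative g (at z)) (at z)"
  by (simp add: frechet_derivative_works)

lemma C_k_Suc_derivative: "C_k (Suc k) g \<Longrightarrow> C_k k (\<lambda>z. frechet_derivative g (at z) h)"
  by simp

lemma C_k_Suc_imp: "C_k (Suc k) g \<Longrightarrow> C_k k g"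
proof (induction k arbitrary: g)
  case 0
  then show ?case
    by (auto simp: continuous_on_eq_continuous_at differentiable_imp_continuous_within)
next
  case (Suc k)
  then show ?case by (metis C_k.simps(2))
qed

lemma C_k_const: "C_k k (\<lambda>_. c)"
proof (induction k arbitrary: c)
  case (Suc k)
  then show ?case by (intro C_k_SucI[where g' = "\<lambda>_ _. 0"]) auto
qed simp

lemma C_k_bounded_linear:
  assumes "bounded_linear L"
  shows "C_k k L"
proof (cases k)
  case 0
  then show ?thesis using assms by (simp add: linear_continuous_on)
next
  case (Suc j)
  then show ?thesis
    using C_k_SucI[of L "\<lambda>_. L" j] assms by (simp add: C_k_const bounded_linear_imp_has_derivative)
qed

lemma C_k_bounded_linear_compose:
  assumes "bounded_linear L"
  shows "C_k k g \<Longrightarrow> C_k k (\<lambda>z. L (g z))"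
proof (induction k arbitrary: g)
  case 0
  then show ?case by (simp add: bounded_linear.continuous_on[OF assms])
next
  case (Suc k)
  show ?case
    using Suc.IH[OF C_k_Suc_derivative[OF Suc.prems]]
    by (intro C_k_SucI[where g' = "\<lambda>z h. L (frechet_derivative g (at z) h)"]
        bounded_linear.has_derivative[OF assms] C_k_Suc_has_derivative[OF Suc.prems])
qed

lemma C_k_add: "C_k k f \<Longrightarrow> C_k k g \<Longrightarrow> C_k k (\<lambda>z. f z + g z)"
proof (induction k arbitrary: f g)
  case 0
  then show ?case by (simp add: continuous_on_add)
next
  case (Suc k)
  show ?case
    using Suc.IH[OF C_k_Suc_derivative[OF Suc.prems(1)] C_k_Suc_derivative[OF Suc.prems(2)]]
    by (intro C_k_SucI[where g' = "\<lambda>z h. frechet_derivative f (at z) h + frechet_derivative g (at z) h"]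
        has_derivative_add Suc.prems[THEN C_k_Suc_has_derivative])
qed

lemma C_k_minus: "C_k k g \<Longrightarrow> C_k k (\<lambda>z. - g z)"
  by (rule C_k_bounded_linear_compose[OF bounded_linear_minus[OF bounded_linear_ident]])

lemma C_k_diff: "C_k k f \<Longrightarrow> C_k k g \<Longrightarrow> C_k k (\<lambda>z. f z - g z)"
  using C_k_add[OF _ C_k_minus, of k f g] by simp

lemma C_k_sum: "(\<And>i. i \<in> I \<Longrightarrow> C_k k (f i)) \<Longrightarrow> C_k k (\<lambda>z. \<Sum>i\<in>I. f i z)"
  by (induction I rule: infinite_finite_induct) (simp_all add: C_k_const C_k_add)

lemma C_k_scaleR:
  fixes a :: "'a::real_normed_vector \<Rightarrow> real"
  shows "C_k k a \<Longrightarrow> C_k k g \<Longrightarrow> C_k k (\<lambda>z. a z *\<^sub>R g z)"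
proof (induction k arbitrary: a g)
  case 0
  then show ?case by (simp add: continuous_on_scaleR)
next
  case (Suc k)
  show ?case
  proof (rule C_k_SucI)
    fix z
    show "((\<lambda>z. a z *\<^sub>R g z) has_derivative
        (\<lambda>h. a z *\<^sub>R frechet_derivative g (at z) h + frechet_derivative a (at z) h *\<^sub>R g z)) (at z)"
      by (intro has_derivative_scaleR Suc.prems[THEN C_k_Suc_has_derivative])
  next
    fix h
    show "C_k k (\<lambda>z. a z *\<^sub>R frechet_derivative g (at z) h + frechet_derivative a (at z) h *\<^sub>R g z)"
      by (intro C_k_add Suc.IH Suc.prems[THEN C_k_Suc_derivative] Suc.prems[THEN C_k_Suc_imp])
  qed
qed

text \<open>Trades a variable direction of differentiation for finitely many fixed ones, the only
  directions that \<open>C_k\<close> speaks about.\<close>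

lemma linear_Basis_expansion:
  fixes L :: "'a::euclidean_space \<Rightarrow> 'b::real_vector"
  assumes "linear L"
  shows "L x = (\<Sum>b\<in>Basis. (x \<bullet> b) *\<^sub>R L b)"
proof -
  have "L x = L (\<Sum>b\<in>Basis. (x \<bullet> b) *\<^sub>R b)" by (simp add: euclidean_representation)
  also have "\<dots> = (\<Sum>b\<in>Basis. (x \<bullet> b) *\<^sub>R L b)"
    by (simp only: linear_sum[OF assms] linear_cmul[OF assms])
  finally show ?thesis .
qed

lemma C_k_compose:
  fixes g :: "'b::euclidean_space \<Rightarrow> 'c::real_normed_vector" and f :: "'a::real_normed_vector \<Rightarrow> 'b"
  shows "C_k k g \<Longrightarrow> C_k k f \<Longrightarrow> C_k k (\<lambda>z. g (f z))"
proof (induction k arbitrary: f g)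
  case 0
  then show ?case using continuous_on_compose2[of UNIV g UNIV f] by simp
next
  case (Suc k)
  show ?case
  proof (rule C_k_SucI)
    fix z
    show "((\<lambda>z. g (f z)) has_derivative
        (\<lambda>h. frechet_derivative g (at (f z)) (frechet_derivative f (at z) h))) (at z)"
      by (rule has_derivative_compose[OF Suc.prems(2)[THEN C_k_Suc_has_derivative]
            Suc.prems(1)[THEN C_k_Suc_has_derivative]])
  next
    fix h
    \<comment> \<open>In the chain rule the direction \<open>frechet_derivative f (at z) h\<close>
      moves with \<open>z\<close>; the expansion turns it into smooth coefficients of derivatives of
      \<open>g\<close> in fixed directions, to which the induction hypothesis applies.\<close>
    have "C_k k (\<lambda>z. \<Sum>b\<in>Basis. (frechet_derivative f (at z) h \<bullet> b) *\<^sub>R frechet_derivative g (at (f z)) b)"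
      by (intro C_k_sum C_k_scaleR C_k_bounded_linear_compose[OF bounded_linear_inner_left]
          C_k_Suc_derivative[OF Suc.prems(2)]
          Suc.IH[OF C_k_Suc_derivative[OF Suc.prems(1)] C_k_Suc_imp[OF Suc.prems(2)]])
    moreover have "linear (frechet_derivative g (at y))" for y
      using C_k_Suc_has_derivative[OF Suc.prems(1)] by (rule has_derivative_linear)
    note linear_Basis_expansion[OF this, symmetric]
    ultimately show "C_k k (\<lambda>z. frechet_derivative g (at (f z)) (frechet_derivative f (at z) h))"
      by simp
  qed
qed

lemma C_k_Pair:
  assumes "C_k k f" "C_k k g"
  shows "C_k k (\<lambda>z. (f z, g z))"
proof -
  have "C_k k (\<lambda>z. (f z, 0) + (0, g z))"
    by (intro C_k_add C_k_bounded_linear_compose[OF _ assms(1)] C_k_bounded_linear_compose[OF _ assms(2)]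
      bounded_linear_Pair bounded_linear_ident bounded_linear_zero)
  then show ?thesis by simp
qed

section \<open>Building blocks of a cutoff: the squared norm and truncated powers\<close>

lemma C_k_inner_self: "C_k k (\<lambda>z::'a::real_inner. z \<bullet> z)"
proof (cases k)
  case (Suc j)
  have "C_k (Suc j) (\<lambda>z::'a. z \<bullet> z)"
  proof (rule C_k_SucI)
    show "((\<lambda>z. z \<bullet> z) has_derivative (\<lambda>h. z \<bullet> h + h \<bullet> z)) (at z)" for z :: 'a
      by (intro derivative_intros)
    show "C_k j (\<lambda>z. z \<bullet> h + h \<bullet> z)" for h :: 'a
      by (intro C_k_bounded_linear bounded_linear_intros)
  qed
  then show ?thesis by (simp only: Suc)
next
  case 0
  then show ?thesis by (simp add: continuous_on_inner continuous_on_id)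
qed

text \<open>An exponent of at least 2 makes the one-sided derivatives at 0 agree: the difference
  quotient there is at most \<open>\<bar>h\<bar> ^ Suc k\<close>.\<close>

lemma has_derivative_truncated_power:
  "((\<lambda>s::real. max 0 s ^ Suc (Suc k)) has_derivative
    (\<lambda>h. (real (Suc (Suc k)) * h) *\<^sub>R max 0 s ^ Suc k)) (at s)"
proof -
  consider "s < 0" | "s > 0" | "s = 0" by linarith
  then show ?thesis
  proof cases
    case 1
    have "((\<lambda>s::real. 0) has_derivative (\<lambda>h. (real (Suc (Suc k)) * h) *\<^sub>R max 0 s ^ Suc k)) (at s)"
      using 1 by simp
    then show ?thesis
      by (rule has_derivative_transform_within_open[where s = "{..<0}"]) (use 1 in auto)
  next
    case 2
    have "((\<lambda>s::real. s ^ Suc (Suc k)) has_derivative (\<lambda>h. (real (Suc (Suc k)) * h) *\<^sub>R max 0 s ^ Suc k)) (at s)"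
    proof (rule has_derivative_eq_rhs)
      show "((\<lambda>s. s ^ Suc (Suc k)) has_derivative
          (*) (real (Suc (Suc k)) * s ^ (Suc (Suc k) - Suc 0))) (at s)"
        using DERIV_pow[of "Suc (Suc k)" s] unfolding has_field_derivative_def .
    qed (use 2 in \<open>auto simp: fun_eq_iff max_def algebra_simps\<close>)
    then show ?thesis
      by (rule has_derivative_transform_within_open[where s = "{0<..}"]) (use 2 in auto)
  next
    case 3
    have lim: "((\<lambda>h::real. \<bar>h\<bar> ^ Suc k) \<longlongrightarrow> 0) (at 0)"
      using tendsto_power[OF tendsto_rabs_zero[OF tendsto_ident_at], of "Suc k"] by simp
    have "((\<lambda>h. max 0 h ^ Suc (Suc k) / h) \<longlongrightarrow> 0) (at (0::real))"
    proof (rule Lim_null_comparison[OF _ lim])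
      show "\<forall>\<^sub>F h in at (0::real). norm (max 0 h ^ Suc (Suc k) / h) \<le> \<bar>h\<bar> ^ Suc k"
        by (intro always_eventually) (auto simp: max_def abs_mult mult_nonpos_nonneg)
    qed
    then have "((\<lambda>s::real. max 0 s ^ Suc (Suc k)) has_field_derivative 0) (at 0)"
      by (simp add: has_field_derivative_iff)
    then show ?thesis using 3 by (simp add: has_field_derivative_def mult_zero_left[abs_def])
  qed
qed

text \<open>Differentiation lowers the exponent by one, down to the merely continuous
  \<open>max 0 s\<close>. This gives cutoffs of any finite smoothness by elementary means.\<close>

lemma C_k_truncated_power: "C_k k (\<lambda>s::real. max 0 s ^ Suc k)"
proof (induction k)
  case 0
  then show ?case by (simp add: continuous_on_max continuous_on_id continuous_on_const)
next
  case (Suc k)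
  show ?case
    by (rule C_k_SucI, rule has_derivative_truncated_power) (intro C_k_scaleR Suc.IH C_k_const)
qed

subsection \<open>Fixed points of parametrized contractions\<close>

text \<open>A difference quotient in direction \<open>h\<close> has norm at most
  \<open>c * norm h\<close>, and so has its limit. Through this the partial derivative of a
  contraction inherits the contraction constant.\<close>

lemma Lipschitz_derivative_bound:
  fixes g :: "'a::real_normed_vector \<Rightarrow> 'b::real_normed_vector"
  assumes d: "(g has_derivative g') (at x)" and lip: "\<And>y. norm (g y - g x) \<le> c * norm (y - x)"
  shows "norm (g' h) \<le> c * norm h"
proof -
  have lin: "linear g'" using d by (rule has_derivative_linear)
  have key: "norm (g' h) \<le> c * norm h + \<epsilon> * norm h" if \<epsilon>: "\<epsilon> > 0" for \<epsilon>
  proof -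
    obtain r where r: "r > 0"
      and est: "\<And>y. norm (y - x) < r \<Longrightarrow> norm (g y - g x - g' (y - x)) \<le> \<epsilon> * norm (y - x)"
      using d \<epsilon> unfolding has_derivative_at_alt by metis
    \<comment> \<open>Scales \<open>h\<close> into the ball where the derivative approximates
      \<open>g\<close>; homogeneity of \<open>g'\<close> lets \<open>s\<close> cancel at the
      end.\<close>
    define s where "s = r / (1 + norm h)"
    have pos: "1 + norm h > 0" by (simp add: add_pos_nonneg)
    have s: "s > 0" using r pos by (simp add: s_def)
    have "norm (s *\<^sub>R h) < r"
      using r pos by (simp add: s_def field_simps)
    then have "norm (g (x + s *\<^sub>R h) - g x - g' (s *\<^sub>R h)) \<le> \<epsilon> * norm (s *\<^sub>R h)"
      using est[of "x + s *\<^sub>R h"] by simp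
    moreover have "norm (g (x + s *\<^sub>R h) - g x) \<le> c * norm (s *\<^sub>R h)"
      using lip[of "x + s *\<^sub>R h"] by simp
    ultimately have "norm (g' (s *\<^sub>R h)) \<le> c * norm (s *\<^sub>R h) + \<epsilon> * norm (s *\<^sub>R h)"
      using norm_triangle_sub[of "g' (s *\<^sub>R h)" "g (x + s *\<^sub>R h) - g x"]
      by (simp add: norm_minus_commute)
    then have "s * norm (g' h) \<le> s * (c * norm h + \<epsilon> * norm h)"
      using s by (simp add: linear_cmul[OF lin] algebra_simps)
    then show ?thesis using s by simp
  qed
  have "norm (g' h) \<le> c * norm h + \<epsilon>" if "\<epsilon> > 0" for \<epsilon>
  proof (cases "h = 0")
    case False
    then show ?thesis using key[of "\<epsilon> / norm h"] that by simp
  qed (use that linear_0[OF lin] in simp)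
  then show ?thesis by (rule field_le_epsilon)
qed

text \<open>Serves to prove that the candidate derivative is linear: a sum or multiple of fixed
  points solves the affine equation for the sum or multiple of the data.\<close>

lemma linear_fixed_point_unique:
  fixes L :: "'b::real_normed_vector \<Rightarrow> 'b"
  assumes "linear L" "\<And>w. norm (L w) \<le> c * norm w" "c < 1" "x = L x + y" "x' = L x' + y"
  shows "x = x'"
proof -
  have "x - x' = L (x - x')" using assms(4,5) linear_diff[OF assms(1), of x x'] by (metis add_diff_cancel_right)
  then have "norm (x - x') \<le> c * norm (x - x')" by (metis assms(2))
  then have "(1 - c) * norm (x - x') \<le> 0" by (simp add: algebra_simps)
  then show ?thesis using \<open>c < 1\<close> by (simp add: mult_le_0_iff)
qed

text \<open>Insert \<open>N e' (V e)\<close> between the two fixed points: the change in the second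
  argument is absorbed by the contraction, so \<open>V\<close> varies at most like \<open>N\<close>
  in its first argument, up to the factor \<open>1 / (1 - c)\<close>.\<close>

lemma fixed_point_difference:
  assumes lip: "\<And>e v v'. norm (N e v - N e v') \<le> c * norm (v - v')" and "c < 1"
    and fp: "\<And>e. N e (V e) = V e"
  shows "norm (V e' - V e) \<le> norm (N e' (V e) - N e (V e)) / (1 - c)"
proof -
  have "V e' - V e = (N e' (V e') - N e' (V e)) + (N e' (V e) - N e (V e))" by (simp add: fp)
  then have "norm (V e' - V e) \<le> norm (N e' (V e') - N e' (V e)) + norm (N e' (V e) - N e (V e))"
    by (metis norm_triangle_ineq)
  also have "\<dots> \<le> c * norm (V e' - V e) + norm (N e' (V e) - N e (V e))" using lip by simp
  finally show ?thesis using \<open>c < 1\<close> by (simp add: field_simps)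
qed

text \<open>
  Differentiating \<open>V e = N e (V e)\<close> shows that a directional derivative of \<open>V\<close> is again a fixed
  point of a uniform contraction, now of class \<open>C\<^sup>k\<close> instead of \<open>C\<^sup>k\<^sup>+\<^sup>1\<close>.
\<close>

lemma C_k_fixed_point:
  fixes N :: "'a::euclidean_space \<Rightarrow> 'b::euclidean_space \<Rightarrow> 'b"
  assumes c: "0 \<le> c" "c < 1"
  shows "C_k k (\<lambda>(e, v). N e v) \<Longrightarrow> (\<And>e v v'. norm (N e v - N e v') \<le> c * norm (v - v')) \<Longrightarrow>
    (\<And>e. N e (V e) = V e) \<Longrightarrow> C_k k V"
proof (induction k arbitrary: N V)
  case 0
  have "isCont V e" for e
  proof -
    have "isCont (\<lambda>e'. (\<lambda>(e, v). N e v) (e', V e)) e"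
    proof (rule isCont_o2[where f = "\<lambda>e'. (e', V e)" and g = "\<lambda>(e, v). N e v"])
      show "isCont (\<lambda>(e, v). N e v) (e, V e)"
        using 0(1) by (simp add: continuous_on_eq_continuous_at)
    qed (intro continuous_intros)
    then have "((\<lambda>e'. norm (N e' (V e) - N e (V e)) / (1 - c)) \<longlongrightarrow> 0) (at e)"
      using c by (auto simp: isCont_def intro!: tendsto_eq_intros)
    then have "((\<lambda>e'. V e' - V e) \<longlongrightarrow> 0) (at e)"
      by (rule Lim_null_comparison[rotated])
        (intro always_eventually allI fixed_point_difference[of N c V] 0 c)
    then show ?thesis by (simp add: isCont_def LIM_zero_iff)
  qed
  then show ?case by (simp add: continuous_on_eq_continuous_at)
next
  case (Suc k)
  define D where "D e = frechet_derivative (\<lambda>(e, v). N e v) (at (e, V e))" for e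
  have D: "((\<lambda>(e, v). N e v) has_derivative D e) (at (e, V e))" for e
    unfolding D_def by (rule C_k_Suc_has_derivative[OF Suc.prems(1)])
  have linD: "linear (D e)" for e
    using D by (rule has_derivative_linear)
  have split: "D e (h, w) = D e (0, w) + D e (h, 0)" for e h w
    using linear_add[OF linD, of e "(0, w)" "(h, 0)"] by simp
  have diff0: "D e (h, w) - D e (h, w') = D e (0, w - w')" for e h w w'
    using linear_diff[OF linD, of e "(h, w)" "(h, w')"] by simp
  have lin0: "linear (\<lambda>w. D e (0, w))" for e
    using linear_compose[OF _ linD, of "\<lambda>w. (0, w)" e]
    by (simp add: o_def bounded_linear.linear[OF bounded_linear_Pair[OF bounded_linear_zero bounded_linear_ident]])
  have D0: "norm (D e (0, w)) \<le> c * norm w" for e w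
  proof (rule Lipschitz_derivative_bound)
    have "((\<lambda>v. (e, v)) has_derivative (\<lambda>w. (0, w))) (at (V e))"
      by (auto intro!: derivative_eq_intros)
    from has_derivative_compose[OF this D]
    show "((\<lambda>v. N e v) has_derivative (\<lambda>w. D e (0, w))) (at (V e))" by simp
  qed (rule Suc.prems)
  \<comment> \<open>\<open>D e\<close> is taken at \<open>(e, V e)\<close>, so the derived
    contraction can be of class \<open>C_k k\<close> only once \<open>V\<close> is; the induction
    hypothesis for the same \<open>N\<close> provides this.\<close>
  have VC: "C_k k V"
    by (rule Suc.IH[OF C_k_Suc_imp[OF Suc.prems(1)] Suc.prems(2,3)])
  \<comment> \<open>The candidate \<open>W e h\<close> for the derivative of \<open>V\<close> in
    direction \<open>h\<close> is the fixed point of the linearized equation, whose contraction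
    constant is again \<open>c\<close>.\<close>
  have "\<exists>!x. D e (h, x) = x" for e h
  proof (rule banach_fix_type[OF c], safe)
    fix x y
    show "dist (D e (h, x)) (D e (h, y)) \<le> c * dist x y"
      using D0[of e "x - y"] by (simp add: diff0 dist_norm)
  qed
  then obtain W where W: "D e (h, W e h) = W e h" for e h by metis
  have W_eq: "W e h = D e (0, W e h) + D e (h, 0)" for e h
    using W[of e h] split[of e h "W e h"] by simp
  have linW: "linear (W e)" for e
  proof
    fix b1 b2
    have "D e (b1 + b2, 0) = D e (b1, 0) + D e (b2, 0)"
      using linear_add[OF linD, of e "(b1, 0)" "(b2, 0)"] by simp
    then have "W e b1 + W e b2 = D e (0, W e b1 + W e b2) + D e (b1 + b2, 0)"
      using W_eq[of e b1] W_eq[of e b2] linear_add[OF lin0, of e] by (simp add: algebra_simps)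
    then show "W e (b1 + b2) = W e b1 + W e b2"
      by (rule linear_fixed_point_unique[OF lin0 D0 c(2) W_eq])
  next
    fix r b
    have "D e (r *\<^sub>R b, 0) = r *\<^sub>R D e (b, 0)"
      using linear_cmul[OF linD, of e r "(b, 0)"] by simp
    then have "r *\<^sub>R W e b = D e (0, r *\<^sub>R W e b) + D e (r *\<^sub>R b, 0)"
      using W_eq[of e b] linear_cmul[OF lin0, of e] by (metis scaleR_right_distrib)
    then show "W e (r *\<^sub>R b) = r *\<^sub>R W e b"
      by (rule linear_fixed_point_unique[OF lin0 D0 c(2) W_eq])
  qed
  have D_C: "C_k k (\<lambda>(e, w). D e (h, 0))" for h
    using C_k_compose[OF C_k_Suc_derivative[OF Suc.prems(1), of "(h, 0)"], of "\<lambda>z. (fst z, V (fst z))"]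
    by (simp add: D_def case_prod_beta' C_k_Pair C_k_bounded_linear bounded_linear_fst
        C_k_compose[OF VC])
  have D_C': "C_k k (\<lambda>(e, w). D e (0, b))" for b
    using C_k_compose[OF C_k_Suc_derivative[OF Suc.prems(1), of "(0, b)"], of "\<lambda>z. (fst z, V (fst z))"]
    by (simp add: D_def case_prod_beta' C_k_Pair C_k_bounded_linear bounded_linear_fst
        C_k_compose[OF VC])
  show ?case
  proof (rule C_k_SucI)
    fix h
    \<comment> \<open>For joint smoothness in \<open>(e, w)\<close> the variable \<open>w\<close>,
      which occurs as a direction, has to be moved into coefficients.\<close>
    have "C_k k (\<lambda>z. (\<Sum>b\<in>Basis. (snd z \<bullet> b) *\<^sub>R D (fst z) (0, b)) + D (fst z) (h, 0))"
      using D_C D_C'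
      by (intro C_k_add C_k_sum C_k_scaleR C_k_bounded_linear_compose[OF bounded_linear_inner_left]
          C_k_bounded_linear[OF bounded_linear_snd])
        (simp_all add: case_prod_beta')
    moreover have "(\<Sum>b\<in>Basis. (snd z \<bullet> b) *\<^sub>R D (fst z) (0, b)) + D (fst z) (h, 0) = D (fst z) (h, snd z)" for z
      by (simp only: linear_Basis_expansion[OF lin0, symmetric] split[of "fst z" h "snd z"])
    ultimately have "C_k k (\<lambda>(e, w). D e (h, w))"
      by (simp add: case_prod_beta')
    then show "C_k k (\<lambda>e. W e h)"
    proof (rule Suc.IH)
      fix e v v'
      show "norm (D e (h, v) - D e (h, v')) \<le> c * norm (v - v')"
        using D0[of e "v - v'"] by (simp add: diff0)
    qed (rule W)
  next
    fix e
    have bV: "bounded_linear (W e)" using linW by (simp add: linear_conv_bounded_linear)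
    \<comment> \<open>The summand 1 pays for the error term of differentiability with tolerance 1;
      dividing by \<open>1 - c\<close> then yields a Lipschitz constant \<open>K1\<close> for
      \<open>V\<close> at \<open>e\<close>.\<close>
    define K where "K = onorm (\<lambda>h. D e (h, 0)) + 1"
    have linh: "bounded_linear (\<lambda>h. D e (h, 0))"
      using linear_compose[OF _ linD, of "\<lambda>w. (w, 0)" e]
      by (simp add: o_def bounded_linear.linear[OF bounded_linear_Pair[OF bounded_linear_ident bounded_linear_zero]]
          linear_conv_bounded_linear)
    have "((\<lambda>e'. (e', V e)) has_derivative (\<lambda>h. (h, 0))) (at e)"
      by (auto intro!: derivative_eq_intros)
    from has_derivative_compose[OF this D]
    have dN: "((\<lambda>e'. N e' (V e)) has_derivative (\<lambda>h. D e (h, 0))) (at e)" by simp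
    have K0: "K > 0" using onorm_pos_le[OF linh] by (simp add: K_def)
    define K1 where "K1 = K / (1 - c)"
    have K1: "K1 > 0" using K0 c by (simp add: K1_def)
    obtain d1 where d1: "d1 > 0" "\<And>y. norm (y - e) < d1 \<Longrightarrow> norm (V y - V e) \<le> K1 * norm (y - e)"
    proof -
      obtain d where d: "d > 0" and
        est: "\<And>y. norm (y - e) < d \<Longrightarrow> norm (N y (V e) - N e (V e) - D e (y - e, 0)) \<le> 1 * norm (y - e)"
        using dN unfolding has_derivative_at_alt by (metis zero_less_one)
      have "norm (V y - V e) \<le> K1 * norm (y - e)" if "norm (y - e) < d" for y
      proof -
        have "norm (N y (V e) - N e (V e)) \<le> norm (D e (y - e, 0)) + norm (N y (V e) - N e (V e) - D e (y - e, 0))"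
          using norm_triangle_sub[of "N y (V e) - N e (V e)" "D e (y - e, 0)"] by simp
        also have "\<dots> \<le> K * norm (y - e)"
          using est[OF that] onorm[OF linh, of "y - e"] by (simp add: K_def algebra_simps)
        finally have "norm (N y (V e) - N e (V e)) / (1 - c) \<le> K1 * norm (y - e)"
          using c divide_right_mono[of _ "K * norm (y - e)" "1 - c"] by (simp add: K1_def)
        then show ?thesis
          using fixed_point_difference[of N c V y e, OF Suc.prems(2) c(2) Suc.prems(3)] by linarith
      qed
      with d that show ?thesis by blast
    qed
    show "(V has_derivative W e) (at e)"
      unfolding has_derivative_at_alt
    proof (intro conjI allI impI)
      fix \<epsilon> :: real assume \<epsilon>: "\<epsilon> > 0"
      \<comment> \<open>Chosen so that \<open>\<eta> * (1 + K1) = \<epsilon> * (1 - c)\<close>: the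
        factor \<open>1 + K1\<close> bounds the increment of the pair \<open>(e, V e)\<close>, and
        \<open>1 - c\<close> is lost when the contraction is absorbed.\<close>
      define \<eta> where "\<eta> = \<epsilon> * (1 - c) / (1 + K1)"
      have \<eta>: "\<eta> > 0" using \<epsilon> c K1 by (simp add: \<eta>_def)
      obtain d2 where d2: "d2 > 0" and
        est: "\<And>z. norm (z - (e, V e)) < d2 \<Longrightarrow>
          norm ((\<lambda>(e, v). N e v) z - (\<lambda>(e, v). N e v) (e, V e) - D e (z - (e, V e))) \<le> \<eta> * norm (z - (e, V e))"
        using D[of e] \<eta> unfolding has_derivative_at_alt by metis
      define d where "d = min d1 (d2 / (1 + K1))"
      have "d > 0" using d1 d2 K1 by (simp add: d_def)
      moreover have "norm (V y - V e - W e (y - e)) \<le> \<epsilon> * norm (y - e)" if y: "norm (y - e) < d" for y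
      proof -
        have Vy: "norm (V y - V e) \<le> K1 * norm (y - e)" using d1 y by (simp add: d_def)
        have nz: "norm (y - e, V y - V e) \<le> (1 + K1) * norm (y - e)"
          using norm_Pair_le[of "y - e" "V y - V e"] Vy by (simp add: algebra_simps)
        have "(1 + K1) * norm (y - e) < d2" using y K1 by (simp add: d_def field_simps)
        then have "norm (N y (V y) - N e (V e) - D e (y - e, V y - V e)) \<le> \<eta> * norm (y - e, V y - V e)"
          using est[of "(y, V y)"] nz by simp
        also have "\<dots> \<le> \<eta> * ((1 + K1) * norm (y - e))" using nz \<eta> by simp
        also have "\<dots> = (1 - c) * (\<epsilon> * norm (y - e))" using K1 by (simp add: \<eta>_def)
        finally have R: "norm (V y - V e - D e (y - e, V y - V e)) \<le> (1 - c) * (\<epsilon> * norm (y - e))"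
          by (simp add: Suc.prems(3))
        \<comment> \<open>The remainder \<open>q\<close> of the expansion of \<open>V\<close> is a
          fixed point of the contraction \<open>D e (0, _)\<close> shifted by the remainder of the
          expansion of \<open>N\<close>, hence of the same order as the latter.\<close>
        define q where "q = V y - V e - W e (y - e)"
        have "D e (0, q) = D e (y - e, V y - V e) - W e (y - e)"
          using W[of e "y - e"] diff0[of e "y - e" "V y - V e" "W e (y - e)"] by (simp add: q_def)
        then have "q = D e (0, q) + (V y - V e - D e (y - e, V y - V e))" by (simp add: q_def)
        then have "norm q \<le> norm (D e (0, q)) + norm (V y - V e - D e (y - e, V y - V e))"
          by (metis norm_triangle_ineq)
        then have "norm q \<le> c * norm q + (1 - c) * (\<epsilon> * norm (y - e))" using D0[of e q] R by linarith
        then have "(1 - c) * norm q \<le> (1 - c) * (\<epsilon> * norm (y - e))" by (simp add: algebra_simps)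
        then show ?thesis using c by (simp add: q_def)
      qed
      ultimately show "\<exists>d>0. \<forall>y. norm (y - e) < d \<longrightarrow> norm (V y - V e - W e (y - e)) \<le> \<epsilon> * norm (y - e)"
        by blast
    qed (rule bV)
  qed
qed

subsection \<open>Smooth truncation\<close>

text \<open>Compactness yields bounds one direction at a time; finitely many of them control all
  directions.\<close>

lemma linear_bound_Basis:
  fixes L :: "'a::euclidean_space \<Rightarrow> 'b::real_normed_vector"
  assumes "linear L" "\<And>b. b \<in> Basis \<Longrightarrow> norm (L b) \<le> K b"
  shows "norm (L h) \<le> (\<Sum>b\<in>Basis. K b) * norm h"
proof -
  have "norm (L h) \<le> (\<Sum>b\<in>Basis. norm ((h \<bullet> b) *\<^sub>R L b))"
    unfolding linear_Basis_expansion[OF assms(1), of h] by (rule norm_sum)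
  also have "\<dots> \<le> (\<Sum>b\<in>Basis. K b * norm h)"
  proof (rule sum_mono)
    fix b :: 'a assume b: "b \<in> Basis"
    have "\<bar>h \<bullet> b\<bar> * norm (L b) \<le> norm h * K b"
      using b assms(2) by (intro mult_mono) (auto simp: Basis_le_norm)
    then show "norm ((h \<bullet> b) *\<^sub>R L b) \<le> K b * norm h" by (simp add: mult.commute)
  qed
  finally show ?thesis by (simp add: sum_distrib_right)
qed

lemma C_k_imp_continuous: "C_k k g \<Longrightarrow> continuous_on UNIV g"
proof (induction k)
  case (Suc k)
  then show ?case using C_k_Suc_imp by blast
qed simp

text \<open>The derivative is bounded on the compact ball and vanishes outside, where
  \<open>g\<close> is locally zero; the mean value inequality does the rest.\<close>

lemma C_1_compact_support_Lipschitz: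
  fixes g :: "'a::euclidean_space \<Rightarrow> 'b::real_normed_vector"
  assumes g: "C_k (Suc k) g" and supp: "\<And>z. norm z > R \<Longrightarrow> g z = 0"
  obtains c where "c > 0" "\<And>x y. norm (g x - g y) \<le> c * norm (x - y)"
proof -
  define D where "D z = frechet_derivative g (at z)" for z
  have D: "(g has_derivative D z) (at z)" for z
    unfolding D_def by (rule C_k_Suc_has_derivative[OF g])
  have "\<exists>K. \<forall>z. norm (D z b) \<le> K" for b
  proof -
    have "continuous_on UNIV (\<lambda>z. D z b)"
      unfolding D_def by (rule C_k_imp_continuous[OF C_k_Suc_derivative[OF g]])
    then have "compact ((\<lambda>z. D z b) ` cball 0 R)"
      by (intro compact_continuous_image) (auto intro: continuous_on_subset)
    then obtain K where K: "K > 0" "\<And>z. z \<in> cball 0 R \<Longrightarrow> norm (D z b) \<le> K"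
      using compact_imp_bounded bounded_pos by (metis imageI)
    have "norm (D z b) \<le> K" for z
    proof (cases "norm z \<le> R")
      case True
      then show ?thesis using K by simp
    next
      case False
      have "open {z::'a. R < norm z}"
        by (intro open_Collect_less continuous_intros)
      then have "(g has_derivative (\<lambda>_. 0)) (at z)"
        by (rule has_derivative_transform_within_open[OF has_derivative_const[of 0]])
          (use False supp in auto)
      then have "D z = (\<lambda>_. 0)" using D has_derivative_unique by blast
      then show ?thesis using K by simp
    qed
    then show ?thesis by blast
  qed
  then obtain K where K: "norm (D z b) \<le> K b" for z b by metis
  define c where "c = (\<Sum>b\<in>(Basis::'a set). K b)"
  have "norm (g x - g y) \<le> c * norm (x - y)" for x y
  proof (rule differentiable_bound[OF convex_UNIV])
    show "(g has_derivative D z) (at z within UNIV)" for z using D by simp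
    show "onorm (D z) \<le> c" for z
      unfolding c_def by (intro onorm_le linear_bound_Basis K has_derivative_linear[OF D])
  qed auto
  then have "norm (g x - g y) \<le> (\<bar>c\<bar> + 1) * norm (x - y)" for x y
    by (rule order_trans) (intro mult_right_mono, auto)
  then show ?thesis by (intro that[of "\<bar>c\<bar> + 1"]) auto
qed

text \<open>With the truncated power \<open>P\<close>, the factor
  \<open>P (1 - P (z \<bullet> z - 1))\<close> is \<open>P 1 = 1\<close> on the unit ball and
  \<open>0\<close> as soon as \<open>z \<bullet> z \<ge> 2\<close>. The squared norm is used because
  the norm is not differentiable at the origin.\<close>

lemma C_k_clamp_unit:
  obtains \<psi> :: "'a::euclidean_space \<Rightarrow> 'a" where "C_k k \<psi>" "\<And>z. norm z \<le> 1 \<Longrightarrow> \<psi> z = z"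
    "\<And>z. norm (\<psi> z) \<le> 2" "\<And>z. norm z > 2 \<Longrightarrow> \<psi> z = 0"
proof -
  define P where "P s = max 0 s ^ Suc k" for s :: real
  define \<psi> where "\<psi> z = P (1 - P (z \<bullet> z - 1)) *\<^sub>R z" for z :: 'a
  have P: "C_k k P" unfolding P_def by (rule C_k_truncated_power)
  have "C_k k \<psi>"
    unfolding \<psi>_def
    by (intro C_k_scaleR C_k_compose[OF P] C_k_diff C_k_const C_k_inner_self
        C_k_bounded_linear bounded_linear_ident)
  moreover have "\<psi> z = z" if "norm z \<le> 1" for z
  proof -
    have "z \<bullet> z \<le> 1" using that by (simp add: norm_le_square)
    then show ?thesis by (simp add: \<psi>_def P_def)
  qed
  moreover have vanish: "\<psi> z = 0" if "2 \<le> z \<bullet> z" for z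
  proof -
    have "1 \<le> P (z \<bullet> z - 1)" using that unfolding P_def by (intro one_le_power) auto
    then have "P (1 - P (z \<bullet> z - 1)) = 0" unfolding P_def[of "1 - _"] by simp
    then show ?thesis by (simp add: \<psi>_def)
  qed
  moreover have "norm (\<psi> z) \<le> 2" for z
  proof (cases "2 \<le> z \<bullet> z")
    case True
    then show ?thesis using vanish by simp
  next
    case False
    then have "norm z \<le> 2" by (simp add: norm_le_square)
    moreover have "0 \<le> P s" for s by (simp add: P_def)
    then have "0 \<le> P (1 - P (z \<bullet> z - 1))" "P (1 - P (z \<bullet> z - 1)) \<le> 1"
      unfolding P_def[of "1 - _"] by (auto intro!: power_le_one simp del: power_Suc)
    ultimately show ?thesis
      using mult_mono[of "P (1 - P (z \<bullet> z - 1))" 1 "norm z" 2] by (simp add: \<psi>_def)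
  qed
  moreover have "\<psi> z = 0" if "norm z > 2" for z
  proof (rule vanish)
    have "2\<^sup>2 \<le> (norm z)\<^sup>2" using that by (intro power_mono) auto
    then show "2 \<le> z \<bullet> z" by (simp add: power2_norm_eq_inner)
  qed
  ultimately show ?thesis using that by blast
qed

text \<open>The rescaling \<open>r *\<^sub>R \<psi> (z /\<^sub>R r)\<close> keeps the Lipschitz
  constant, so \<open>c\<close> can be fixed before \<open>r\<close>. This matters because the
  truncation radii will depend on the bound for the inverse Jacobian.\<close>

lemma C_k_clamp:
  obtains c where "c > 0" "\<And>r. r > 0 \<Longrightarrow> \<exists>\<psi> :: 'a::euclidean_space \<Rightarrow> 'a. C_k k \<psi> \<and>
    (\<forall>z. norm z \<le> r \<longrightarrow> \<psi> z = z) \<and> (\<forall>z. norm (\<psi> z) \<le> 2 * r) \<and>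
    (\<forall>x y. norm (\<psi> x - \<psi> y) \<le> c * norm (x - y))"
proof -
  obtain \<psi> :: "'a \<Rightarrow> 'a" where \<psi>: "C_k (Suc k) \<psi>" "\<And>z. norm z \<le> 1 \<Longrightarrow> \<psi> z = z"
    "\<And>z. norm (\<psi> z) \<le> 2" "\<And>z. norm z > 2 \<Longrightarrow> \<psi> z = 0"
    \<comment> \<open>One extra degree of smoothness guarantees the derivative from which the
      Lipschitz constant is obtained, also for \<open>k = 0\<close>.\<close>
    using C_k_clamp_unit[of "Suc k"] by metis
  obtain c where c: "c > 0" "\<And>x y. norm (\<psi> x - \<psi> y) \<le> c * norm (x - y)"
    using C_1_compact_support_Lipschitz[OF \<psi>(1,4)] by metis
  show ?thesis
  proof (rule that[OF c(1)])
    fix r :: real assume r: "r > 0"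
    define \<phi> where "\<phi> z = r *\<^sub>R \<psi> (z /\<^sub>R r)" for z
    have "C_k k \<phi>"
      unfolding \<phi>_def
      by (intro C_k_scaleR C_k_const C_k_compose[OF C_k_Suc_imp[OF \<psi>(1)]]
          C_k_bounded_linear bounded_linear_scaleR_right)
    moreover have "\<phi> z = z" if "norm z \<le> r" for z
      using \<psi>(2)[of "z /\<^sub>R r"] that r by (simp add: \<phi>_def field_simps)
    moreover have "norm (\<phi> z) \<le> 2 * r" for z
      using \<psi>(3)[of "z /\<^sub>R r"] r by (simp add: \<phi>_def)
    moreover have "norm (\<phi> x - \<phi> y) \<le> c * norm (x - y)" for x y
    proof -
      have "norm (\<phi> x - \<phi> y) = r * norm (\<psi> (x /\<^sub>R r) - \<psi> (y /\<^sub>R r))"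
        using r by (simp add: \<phi>_def flip: scaleR_diff_right)
      also have "\<dots> \<le> r * (c * norm (x /\<^sub>R r - y /\<^sub>R r))"
        using c(2) r by (intro mult_left_mono) auto
      also have "\<dots> = c * norm (x - y)"
        using r by (simp flip: scaleR_diff_right)
      finally show ?thesis .
    qed
    ultimately show "\<exists>\<psi> :: 'a \<Rightarrow> 'a. C_k k \<psi> \<and> (\<forall>z. norm z \<le> r \<longrightarrow> \<psi> z = z) \<and>
      (\<forall>z. norm (\<psi> z) \<le> 2 * r) \<and> (\<forall>x y. norm (\<psi> x - \<psi> y) \<le> c * norm (x - y))"
      by blast
  qed
qed

subsection \<open>Uniform bounds on derivatives with a parameter\<close>

lemma C_k_param_continuous: "C_k_param k g \<Longrightarrow> continuous_on UNIV (\<lambda>(z, q). g z q)"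
proof (cases k)
  case (Suc j)
  assume "C_k_param k g"
  then show ?thesis unfolding Suc C_k_param.simps by (elim conjE)
qed simp

lemma C_k_param_imp_C_k: "C_k_param k g \<Longrightarrow> C_k k (\<lambda>z. g z q)"
proof (induction k arbitrary: g)
  case 0
  then have "continuous_on UNIV (\<lambda>(z, q). g z q)" by simp
  moreover have "continuous_on UNIV (\<lambda>z. (z, q))" by (intro continuous_intros)
  ultimately have "continuous_on UNIV (\<lambda>z. (\<lambda>(z, q). g z q) (z, q))"
    by (rule continuous_on_compose2) simp
  then show ?case by simp
next
  case (Suc k)
  show ?case
    unfolding C_k.simps
  proof (intro conjI allI)
    show "C_k k (\<lambda>z. frechet_derivative (\<lambda>z. g z q) (at z) h)" for h
      using Suc.prems by (intro Suc.IH[of "\<lambda>z q. frechet_derivative (\<lambda>z. g z q) (at z) h"]) simp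
  qed (use Suc.prems in simp)
qed

lemma C_k_param_has_derivative:
  "C_k_param (Suc k) g \<Longrightarrow>
    ((\<lambda>z. g z q) has_derivative frechet_derivative (\<lambda>z. g z q) (at z)) (at z)"
  unfolding C_k_param.simps by (elim conjE) (simp only: frechet_derivative_works)

text \<open>Joint continuity in \<open>z\<close> and \<open>q\<close> makes the bound uniform over
  the compact product, and thereby later over all times.\<close>

lemma C_k_param_derivative_bound:
  fixes g :: "'a::euclidean_space \<Rightarrow> 'p::topological_space \<Rightarrow> 'b::real_normed_vector"
  assumes g: "C_k_param (Suc k) g" and "compact S" "compact Q"
  obtains K where "K \<ge> 0" "\<And>z q h. z \<in> S \<Longrightarrow> q \<in> Q \<Longrightarrow>
    norm (frechet_derivative (\<lambda>z. g z q) (at z) h) \<le> K * norm h"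
proof -
  have "\<exists>K. \<forall>z\<in>S. \<forall>q\<in>Q. norm (frechet_derivative (\<lambda>z. g z q) (at z) b) \<le> K" for b
  proof -
    have "continuous_on UNIV (\<lambda>(z, q). frechet_derivative (\<lambda>z. g z q) (at z) b)"
      using g by (intro C_k_param_continuous[of k]) simp
    then have "compact ((\<lambda>(z, q). frechet_derivative (\<lambda>z. g z q) (at z) b) ` (S \<times> Q))"
      using assms by (intro compact_continuous_image compact_Times) (auto intro: continuous_on_subset)
    then obtain K where "\<forall>y\<in>(\<lambda>(z, q). frechet_derivative (\<lambda>z. g z q) (at z) b) ` (S \<times> Q). norm y \<le> K"
      using compact_imp_bounded bounded_iff by metis
    then show ?thesis by auto
  qed
  then obtain K where K: "\<And>b z q. z \<in> S \<Longrightarrow> q \<in> Q \<Longrightarrow>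
      norm (frechet_derivative (\<lambda>z. g z q) (at z) b) \<le> K b"
    by metis
  show ?thesis
  proof (rule that[of "\<Sum>b\<in>(Basis::'a set). \<bar>K b\<bar>"])
    fix z q h assume zq: "z \<in> S" "q \<in> Q"
    show "norm (frechet_derivative (\<lambda>z. g z q) (at z) h) \<le> (\<Sum>b\<in>(Basis::'a set). \<bar>K b\<bar>) * norm h"
    proof (rule linear_bound_Basis)
      show "linear (frechet_derivative (\<lambda>z. g z q) (at z))"
        by (rule has_derivative_linear[OF C_k_param_has_derivative[OF g]])
      show "norm (frechet_derivative (\<lambda>z. g z q) (at z) b) \<le> \<bar>K b\<bar>" for b
        using K[OF zq, of b] by simp
    qed
  qed (simp add: sum_nonneg)
qed

text \<open>The mean value inequality on the convex set \<open>S\<close>, applied to the first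
  derivative in each basis direction: second derivatives are bounded by compactness. This is where
  smoothness of order 2 enters.\<close>

lemma C_k_param_derivative_Lipschitz:
  fixes g :: "'a::euclidean_space \<Rightarrow> 'p::topological_space \<Rightarrow> 'b::real_normed_vector"
  assumes g: "C_k_param (Suc (Suc k)) g" and S: "compact S" "convex S" and Q: "compact Q"
  obtains L where "L \<ge> 0" "\<And>z z' q h. z \<in> S \<Longrightarrow> z' \<in> S \<Longrightarrow> q \<in> Q \<Longrightarrow>
    norm (frechet_derivative (\<lambda>z. g z q) (at z) h - frechet_derivative (\<lambda>z. g z q) (at z') h)
      \<le> L * norm (z - z') * norm h"
proof -
  define D where "D z q = frechet_derivative (\<lambda>z. g z q) (at z)" for z q
  have D: "C_k_param (Suc k) (\<lambda>z q. D z q b)" for b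
    unfolding D_def using g by simp
  have lin: "linear (D z q)" for z q
    unfolding D_def by (rule has_derivative_linear[OF C_k_param_has_derivative[OF g]])
  have "\<exists>K\<ge>0. \<forall>z\<in>S. \<forall>z'\<in>S. \<forall>q\<in>Q. norm (D z q b - D z' q b) \<le> K * norm (z - z')" for b
  proof -
    obtain K where K: "K \<ge> 0" "\<And>z q h. z \<in> S \<Longrightarrow> q \<in> Q \<Longrightarrow>
        norm (frechet_derivative (\<lambda>z. D z q b) (at z) h) \<le> K * norm h"
      using C_k_param_derivative_bound[OF D S(1) Q] by metis
    have "norm (D z q b - D z' q b) \<le> K * norm (z - z')" if "z \<in> S" "z' \<in> S" "q \<in> Q" for z z' q
    proof (rule differentiable_bound[OF S(2) _ _ that(1,2)])
      fix x assume "x \<in> S"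
      show "((\<lambda>z. D z q b) has_derivative frechet_derivative (\<lambda>z. D z q b) (at x)) (at x within S)"
        by (rule has_derivative_at_withinI[OF C_k_param_has_derivative[OF D]])
      show "onorm (frechet_derivative (\<lambda>z. D z q b) (at x)) \<le> K"
        by (intro onorm_le K that \<open>x \<in> S\<close>)
    qed
    with K(1) show ?thesis by blast
  qed
  then obtain K where K: "\<And>b. K b \<ge> 0" "\<And>b z z' q. z \<in> S \<Longrightarrow> z' \<in> S \<Longrightarrow> q \<in> Q \<Longrightarrow>
      norm (D z q b - D z' q b) \<le> K b * norm (z - z')"
    by metis
  show ?thesis
  proof (rule that[of "\<Sum>b\<in>(Basis::'a set). K b"])
    fix z z' q h assume z: "z \<in> S" "z' \<in> S" "q \<in> Q"
    have "norm (D z q h - D z' q h) \<le> (\<Sum>b\<in>(Basis::'a set). K b * norm (z - z')) * norm h"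
      by (intro linear_bound_Basis linear_compose_sub lin K(2) z)
    then show "norm (frechet_derivative (\<lambda>z. g z q) (at z) h - frechet_derivative (\<lambda>z. g z q) (at z') h)
        \<le> (\<Sum>b\<in>(Basis::'a set). K b) * norm (z - z') * norm h"
      by (simp add: D_def sum_distrib_right)
  qed (simp add: sum_nonneg K)
qed

subsection \<open>Exact linearization by feedback\<close>

text \<open>
  Composing both arguments of the contraction with truncations makes it global, so that the implicit
  function \<open>V\<close> is of class \<open>C\<^sup>k\<close> on the whole space. Near the origin the truncations are the
  identity.
\<close>

lemma exact_linearizing_feedback:
  fixes G :: "'a::euclidean_space \<times> 'b::euclidean_space \<Rightarrow> 'p::topological_space \<Rightarrow> 'c::real_normed_vector"
    and T :: "'a \<Rightarrow> 'c"
  assumes G: "C_k_param k G" and k: "k \<ge> 2" and Q: "compact Q" and T: "bounded_linear T"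
  obtains c where "c > 0" "\<And>a b q Bi M.
    norm a \<le> ra \<Longrightarrow> norm b \<le> rb \<Longrightarrow> q \<in> Q \<Longrightarrow> bounded_linear Bi \<Longrightarrow> inj Bi \<Longrightarrow> M \<ge> 1 \<Longrightarrow>
    (\<And>y. norm (Bi y) \<le> M * norm y) \<Longrightarrow>
    (\<And>h. Bi (frechet_derivative (\<lambda>z. G z q) (at (a, b)) (0, h)) = h) \<Longrightarrow>
    \<exists>V. C_k k V \<and> (\<forall>e. norm e \<le> c / M\<^sup>2 \<longrightarrow> G (a + e, b + V e) q = G (a, b) q + T e)"
proof -
  obtain j where j: "k = Suc (Suc j)" using k by (metis add_2_eq_Suc le_Suc_ex)
  \<comment> \<open>The margin 1 around the reference points leaves room for perturbations of size
    \<open>2 * r \<le> 1\<close>.\<close>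
  define S where "S = cball (0::'a) (ra + 1) \<times> cball (0::'b) (rb + 1)"
  have S: "compact S" "convex S" by (auto simp: S_def compact_Times convex_Times)
  define D where "D z q = frechet_derivative (\<lambda>z. G z q) (at z)" for z q
  have D: "((\<lambda>z. G z q) has_derivative D z q) (at z)" for z q
    using C_k_param_has_derivative[of "Suc j" G] G unfolding D_def j by blast
  have linD: "linear (D z q)" for z q using D by (rule has_derivative_linear)
  obtain K where K: "K \<ge> 0" "\<And>z q h. z \<in> S \<Longrightarrow> q \<in> Q \<Longrightarrow> norm (D z q h) \<le> K * norm h"
    using C_k_param_derivative_bound[of "Suc j" G S Q] G S Q unfolding D_def j by metis
  obtain L where L: "L \<ge> 0" "\<And>z z' q h. z \<in> S \<Longrightarrow> z' \<in> S \<Longrightarrow> q \<in> Q \<Longrightarrow>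
      norm (D z q h - D z' q h) \<le> L * norm (z - z') * norm h"
    using C_k_param_derivative_Lipschitz[of j G S Q] G S Q unfolding D_def j by metis
  obtain KT where KT: "KT \<ge> 0" "\<And>e. norm (T e) \<le> KT * norm e"
    using bounded_linear.nonneg_bounded[OF T] by (metis mult.commute)
  obtain c1 where c1: "c1 > 0" "\<And>r. r > 0 \<Longrightarrow> \<exists>\<psi> :: 'a \<Rightarrow> 'a. C_k k \<psi> \<and>
    (\<forall>z. norm z \<le> r \<longrightarrow> \<psi> z = z) \<and> (\<forall>z. norm (\<psi> z) \<le> 2 * r) \<and>
    (\<forall>x y. norm (\<psi> x - \<psi> y) \<le> c1 * norm (x - y))" by (rule C_k_clamp[where k = k]) blast
  obtain c2 where c2: "c2 > 0" "\<And>r. r > 0 \<Longrightarrow> \<exists>\<psi> :: 'b \<Rightarrow> 'b. C_k k \<psi> \<and>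
    (\<forall>z. norm z \<le> r \<longrightarrow> \<psi> z = z) \<and> (\<forall>z. norm (\<psi> z) \<le> 2 * r) \<and>
    (\<forall>x y. norm (\<psi> x - \<psi> y) \<le> c2 * norm (x - y))" by (rule C_k_clamp[where k = k]) blast
  \<comment> \<open>Two demands: \<open>2 * r0 \<le> 1\<close> keeps the perturbed points in
    \<open>S\<close>, and \<open>4 * L * r0 * c2 \<le> 1 / 2\<close> gives a contraction with
    constant \<open>1 / 2\<close> after truncation, which costs the factor
    \<open>c2\<close>.\<close>
  define r0 where "r0 = 1 / (2 + 8 * L * c2)"
  have r0: "r0 > 0" "2 * r0 \<le> 1" "4 * L * r0 * c2 \<le> 1 / 2"
    using L(1) c2(1) by (auto simp: r0_def field_simps add_pos_nonneg)
  \<comment> \<open>Makes \<open>2 * (K + KT) * c \<le> r0\<close>, by which the fixed point will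
    lie in the ball where the truncation is the identity.\<close>
  define c where "c = r0 / (2 * (K + KT) + 1)"
  have den: "2 * (K + KT) + 1 > 0" using K(1) KT(1) by simp
  have c: "c > 0" "c \<le> r0" "2 * (K + KT) * c \<le> r0"
    using r0 K(1) KT(1) den by (auto simp: c_def field_simps)
  show ?thesis
  proof (rule that[OF c(1)])
    fix a :: 'a and b :: 'b and q and Bi :: "'c \<Rightarrow> 'b" and M
    assume ab: "norm a \<le> ra" "norm b \<le> rb" and q: "q \<in> Q" and Bi: "bounded_linear Bi" and inj: "inj Bi"
      and M: "M \<ge> 1" and BiM: "\<And>y. norm (Bi y) \<le> M * norm y"
      and inv: "\<And>h. Bi (frechet_derivative (\<lambda>z. G z q) (at (a, b)) (0, h)) = h"
    note linBi = bounded_linear.linear[OF Bi]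
    \<comment> \<open>\<open>r\<close> is the radius for the correction and \<open>\<rho>\<close>
      the one for the error. One factor \<open>1 / M\<close> offsets the norm of \<open>Bi\<close>
      in the contraction estimate, a second one offsets it in the bound for the size of the fixed
      point.\<close>
    define r where "r = r0 / M"
    define \<rho> where "\<rho> = c / M\<^sup>2"
    have r: "r > 0" "2 * r \<le> 1" "M * r = r0"
      using r0 M mult_mono[of "2 * r0" 1 1 M] by (auto simp: r_def field_simps)
    have \<rho>: "\<rho> > 0" "\<rho> \<le> r"
    proof -
      have "c / M\<^sup>2 \<le> r0 / M\<^sup>2" using c M by (simp add: divide_right_mono)
      also have "\<dots> \<le> r0 / M"
        using r0 M by (intro divide_left_mono) (auto simp: power2_eq_square)
      finally show "\<rho> \<le> r" by (simp add: \<rho>_def r_def)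
    qed (use c M in \<open>simp add: \<rho>_def\<close>)
    have \<rho>r: "2 * (M * ((K + KT) * \<rho>)) \<le> r"
    proof -
      have "2 * (M * ((K + KT) * \<rho>)) = 2 * (K + KT) * c / M"
        using M by (simp add: \<rho>_def power2_eq_square)
      also have "\<dots> \<le> r0 / M" using c(3) M by (simp add: divide_right_mono)
      finally show ?thesis by (simp add: r_def)
    qed
    obtain \<psi>1 :: "'a \<Rightarrow> 'a" where \<psi>1: "C_k k \<psi>1" "\<And>z. norm z \<le> \<rho> \<Longrightarrow> \<psi>1 z = z"
      "\<And>z. norm (\<psi>1 z) \<le> 2 * \<rho>" using c1(2)[OF \<rho>(1)] by blast
    obtain \<psi>2 :: "'b \<Rightarrow> 'b" where \<psi>2: "C_k k \<psi>2" "\<And>z. norm z \<le> r \<Longrightarrow> \<psi>2 z = z"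
      "\<And>z. norm (\<psi>2 z) \<le> 2 * r" "\<And>x y. norm (\<psi>2 x - \<psi>2 y) \<le> c2 * norm (x - y)"
      using c2(2)[OF r(1)] by blast
    have inS: "(a + x, b + y) \<in> S" if "norm x \<le> 2 * r" "norm y \<le> 2 * r" for x y
      using norm_triangle_ineq[of a x] norm_triangle_ineq[of b y] ab that r(2)
      by (simp add: S_def)
    have abS: "(a, b) \<in> S" using inS[of 0 0] r(1) by simp
    \<comment> \<open>A simplified Newton map with the derivative frozen at \<open>(a, b)\<close>.
      Since \<open>Bi\<close> is injective, its fixed points are exactly the solutions of the
      equation to be solved.\<close>
    define N where "N x y = y - Bi (G (a + x, b + y) q - G (a, b) q - T x)" for x y
    have N_lip: "norm (N x y - N x y') \<le> 4 * L * r0 * norm (y - y')"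
      if x: "norm x \<le> 2 * r" and y: "norm y \<le> 2 * r" "norm y' \<le> 2 * r" for x y y'
    proof (rule differentiable_bound[where S = "cball 0 (2 * r)" and f = "N x"
          and f' = "\<lambda>y h. h - Bi (D (a + x, b + y) q (0, h))"])
      fix y assume y: "y \<in> cball (0::'b) (2 * r)"
      have "((\<lambda>y. (a + x, b + y)) has_derivative (\<lambda>h. (0, h))) (at y)"
        by (auto intro!: derivative_eq_intros)
      from has_derivative_compose[OF this D]
      have "((\<lambda>y. G (a + x, b + y) q) has_derivative (\<lambda>h. D (a + x, b + y) q (0, h))) (at y)" .
      then have "((\<lambda>y. G (a + x, b + y) q - G (a, b) q - T x) has_derivative
          (\<lambda>h. D (a + x, b + y) q (0, h) - 0 - 0)) (at y)"
        by (intro has_derivative_diff has_derivative_const)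
      then have "((\<lambda>y. G (a + x, b + y) q - G (a, b) q - T x) has_derivative
          (\<lambda>h. D (a + x, b + y) q (0, h))) (at y)" by simp
      then have "((\<lambda>y. N x y) has_derivative (\<lambda>h. h - Bi (D (a + x, b + y) q (0, h)))) (at y)"
        unfolding N_def by (intro has_derivative_diff has_derivative_ident bounded_linear.has_derivative[OF Bi])
      then show "(N x has_derivative (\<lambda>h. h - Bi (D (a + x, b + y) q (0, h)))) (at y within cball 0 (2 * r))"
        by (rule has_derivative_at_withinI)
      show "onorm (\<lambda>h. h - Bi (D (a + x, b + y) q (0, h))) \<le> 4 * L * r0"
      proof (rule onorm_le)
        fix h
        \<comment> \<open>As \<open>Bi\<close> inverts the derivative at \<open>(a, b)\<close>, the
          derivative of \<open>N\<close> measures only how much \<open>D\<close> changes between the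
          two base points.\<close>
        have "h - Bi (D (a + x, b + y) q (0, h)) = Bi (D (a, b) q (0, h) - D (a + x, b + y) q (0, h))"
          using inv[of h] by (simp add: D_def linear_diff[OF linBi])
        then have "norm (h - Bi (D (a + x, b + y) q (0, h)))
            \<le> M * norm (D (a, b) q (0, h) - D (a + x, b + y) q (0, h))"
          using BiM by simp
        also have "\<dots> \<le> M * (L * norm ((a, b) - (a + x, b + y)) * norm (0::'a, h))"
          using M x y by (intro mult_left_mono L(2) abS inS q) auto
        also have "\<dots> \<le> M * (L * (4 * r) * norm h)"
        proof -
          have "norm ((a, b) - (a + x, b + y)) \<le> 4 * r"
            using norm_Pair_le[of "-x" "-y"] x y by simp
          then show ?thesis using M L(1) r(1) by (intro mult_left_mono mult_mono) auto
        qed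
        also have "\<dots> = 4 * L * r0 * norm h" using r(3) by (simp flip: r(3))
        finally show "norm (h - Bi (D (a + x, b + y) q (0, h))) \<le> 4 * L * r0 * norm h" .
      qed
    qed (use y in auto)
    have N0: "norm (N x 0) \<le> M * ((K + KT) * norm x)" if x: "norm x \<le> 2 * r" for x
    proof -
      have "norm (G (a + x, b) q - G (a, b) q) \<le> K * norm ((a + x, b) - (a, b))"
      proof (rule differentiable_bound[OF S(2)])
        show "((\<lambda>z. G z q) has_derivative D z q) (at z within S)" for z
          by (rule has_derivative_at_withinI[OF D])
        show "onorm (D z q) \<le> K" if "z \<in> S" for z
          using that q by (intro onorm_le K(2))
        show "(a + x, b) \<in> S" using inS[of x 0] x r(1) by simp
      qed (rule abS)
      then have *: "norm (G (a + x, b) q - G (a, b) q) \<le> K * norm x" by simp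
      have "norm (N x 0) \<le> M * norm (G (a + x, b) q - G (a, b) q - T x)"
        using BiM by (simp add: N_def)
      also have "\<dots> \<le> M * (K * norm x + KT * norm x)"
        using M * KT(2)[of x] norm_triangle_ineq4[of "G (a + x, b) q - G (a, b) q" "T x"]
        by (intro mult_left_mono) linarith+
      finally show ?thesis by (simp add: algebra_simps)
    qed
    \<comment> \<open>The truncated arguments always lie in the balls of radius \<open>2 * r\<close>
      where \<open>N_lip\<close> holds, so the contraction becomes global.\<close>
    define N' where "N' x y = N (\<psi>1 x) (\<psi>2 y)" for x y
    have \<psi>1r: "norm (\<psi>1 z) \<le> 2 * r" for z using \<psi>1(3)[of z] \<rho>(2) by linarith
    have N'_lip: "norm (N' x y - N' x y') \<le> 1 / 2 * norm (y - y')" for x y y'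
    proof -
      have "norm (N' x y - N' x y') \<le> 4 * L * r0 * norm (\<psi>2 y - \<psi>2 y')"
        unfolding N'_def by (intro N_lip \<psi>1r \<psi>2(3))
      also have "\<dots> \<le> 4 * L * r0 * (c2 * norm (y - y'))"
        using L(1) r0(1) by (intro mult_left_mono \<psi>2(4)) auto
      also have "\<dots> \<le> 1 / 2 * norm (y - y')"
        using mult_right_mono[OF r0(3), of "norm (y - y')"] by (simp add: mult_ac)
      finally show ?thesis .
    qed
    have "\<exists>!y. N' x y = y" for x
      by (rule banach_fix_type[of "1/2"]) (use N'_lip in \<open>auto simp: dist_norm\<close>)
    then obtain V where V: "N' x (V x) = V x" for x by metis
    have C1: "C_k k (\<lambda>z. \<psi>1 (fst z))" "C_k k (\<lambda>z. \<psi>2 (snd z))"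
      by (intro C_k_compose[OF \<psi>1(1)] C_k_compose[OF \<psi>2(1)] C_k_bounded_linear
          bounded_linear_fst bounded_linear_snd)+
    have "C_k k (\<lambda>z. (\<lambda>z. G z q) (a + \<psi>1 (fst z), b + \<psi>2 (snd z)))"
      by (intro C_k_compose[OF C_k_param_imp_C_k[OF G]] C_k_Pair C_k_add C_k_const C1)
    then have "C_k k (\<lambda>(x, y). N' x y)"
      unfolding N'_def N_def case_prod_beta'
      by (intro C_k_diff C1 C_k_bounded_linear_compose[OF Bi] C_k_const C_k_bounded_linear_compose[OF T])
    then have "C_k k V"
      by (rule C_k_fixed_point[of "1/2", rotated 2]) (use N'_lip V in auto)
    moreover have "G (a + e, b + V e) q = G (a, b) q + T e" if e: "norm e \<le> c / M\<^sup>2" for e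
    proof -
      have e\<rho>: "norm e \<le> \<rho>" using e by (simp add: \<rho>_def)
      then have e2: "norm e \<le> 2 * r" using \<rho> r by linarith
      have "norm (V e) \<le> norm (N' e (V e) - N' e 0) + norm (N' e 0)"
        using norm_triangle_ineq[of "N' e (V e) - N' e 0" "N' e 0"] by (simp add: V)
      then have "norm (V e) \<le> 2 * norm (N' e 0)" using N'_lip[of e "V e" 0] by simp
      also have "N' e 0 = N e 0" using e\<rho> r by (simp add: N'_def \<psi>1 \<psi>2)
      also have "2 * norm (N e 0) \<le> 2 * (M * ((K + KT) * norm e))" using N0[OF e2] by simp
      also have "\<dots> \<le> 2 * (M * ((K + KT) * \<rho>))"
        using M K(1) KT(1) e\<rho> by (intro mult_left_mono) auto
      finally have "norm (V e) \<le> r" using \<rho>r by linarith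
      then have "N e (V e) = V e" using V[of e] e\<rho> by (simp add: N'_def \<psi>1 \<psi>2)
      then have "Bi (G (a + e, b + V e) q - G (a, b) q - T e) = Bi 0"
        by (simp add: N_def linear_0[OF linBi])
      then have "G (a + e, b + V e) q - G (a, b) q - T e = 0" using inj by (simp add: inj_eq)
      then show ?thesis by (simp add: algebra_simps)
    qed
    ultimately show "\<exists>V. C_k k V \<and> (\<forall>e. norm e \<le> c / M\<^sup>2 \<longrightarrow> G (a + e, b + V e) q = G (a, b) q + T e)"
      by blast
  qed
qed

section \<open>Inverse Jacobian matrices and the feedback along the reference trajectory\<close>

lemma matrix_inv_mult:
  fixes A :: "real^'n^'n"
  assumes "rank A = CARD('n)"
  shows "A ** matrix_inv A = mat 1" "matrix_inv A ** A = mat 1"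
proof -
  have "invertible A"
    using assms by (simp add: full_rank_injective invertible_left_inverse matrix_left_invertible_injective)
  then have "A ** matrix_inv A = mat 1 \<and> matrix_inv A ** A = mat 1"
    unfolding matrix_inv_def invertible_def by (rule someI_ex)
  then show "A ** matrix_inv A = mat 1" "matrix_inv A ** A = mat 1" by auto
qed

text \<open>Cauchy-Schwarz in each row; it converts the assumed Frobenius bounds into the operator
  bounds of the contraction argument.\<close>

lemma norm_matrix_vector_le_frobenius:
  fixes M :: "real^'n^'m"
  shows "norm (M *v x) \<le> frobenius_norm M * norm x"
proof (rule power2_le_imp_le)
  have sq: "(norm y)\<^sup>2 = (\<Sum>i\<in>UNIV. (y $ i)\<^sup>2)" for y :: "real^'k"
    by (simp add: norm_vec_def L2_set_def sum_nonneg)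
  have "((M *v x) $ i)\<^sup>2 \<le> (norm (M $ i))\<^sup>2 * (norm x)\<^sup>2" for i
  proof -
    have "\<bar>(M *v x) $ i\<bar> \<le> norm (M $ i) * norm x"
      by (simp add: matrix_vector_mul_component Cauchy_Schwarz_ineq2)
    then have "\<bar>(M *v x) $ i\<bar>\<^sup>2 \<le> (norm (M $ i) * norm x)\<^sup>2" by (rule power_mono) simp
    then show ?thesis by (simp add: power_mult_distrib)
  qed
  then have "(norm (M *v x))\<^sup>2 \<le> (\<Sum>i\<in>UNIV. (norm (M $ i))\<^sup>2 * (norm x)\<^sup>2)"
    unfolding sq[of "M *v x"] by (rule sum_mono)
  also have "\<dots> = (frobenius_norm M * norm x)\<^sup>2"
    by (simp add: frobenius_norm_def power_mult_distrib sum_nonneg sum_distrib_right sq)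
  finally show "(norm (M *v x))\<^sup>2 \<le> (frobenius_norm M * norm x)\<^sup>2" .
  show "0 \<le> frobenius_norm M * norm x" by (simp add: frobenius_norm_def sum_nonneg)
qed

text \<open>The bounds on reference and disturbance confine all base points to one compact set, so a
  single \<open>c\<close> serves for all times; time enters only through the norm of the inverse
  Jacobian, whose square gives the rate \<open>2 * \<nu>\<close>.\<close>

lemma exact_linearization_along_trajectory:
  fixes f :: "real^'n \<Rightarrow> real^'n \<Rightarrow> real^'p \<Rightarrow> real^'n" and \<Delta> :: "real^'n^'n"
  assumes k: "k \<ge> 2"
    and f: "C_k_param k (\<lambda>(x, u) q. f x u q)"
    and bounds: "\<And>t. t \<ge> 0 \<Longrightarrow> norm (xd t) \<le> \<gamma>x \<and> norm (ud t) \<le> \<gamma>u \<and> norm (w t) \<le> \<gamma>w"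
    and rank: "\<And>t. t \<ge> 0 \<Longrightarrow> rank (jacobian (\<lambda>u. f (xd t) u (w t)) (at (ud t))) = CARD('n)"
    and \<beta>: "\<beta> > 0" and \<nu>: "\<nu> \<ge> 0"
    and inv: "\<And>t. t \<ge> 0 \<Longrightarrow>
      frobenius_norm (matrix_inv (jacobian (\<lambda>u. f (xd t) u (w t)) (at (ud t)))) \<le> \<beta> * exp (\<nu> * t)"
  obtains v c where "c > 0" "\<And>t. t \<ge> 0 \<Longrightarrow> C_k k (\<lambda>e. v (xd t) (ud t) e (w t))"
    "\<And>t e. t \<ge> 0 \<Longrightarrow> norm e \<le> c * exp (- (2 * \<nu>) * t) \<Longrightarrow>
      f (xd t + e) (ud t + v (xd t) (ud t) e (w t)) (w t) = f (xd t) (ud t) (w t) + \<Delta> *v e"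
proof -
  define G where "G = (\<lambda>(x, u) q. f x u q)"
  have G: "C_k_param k G" using f by (simp add: G_def)
  obtain j where j: "k = Suc j" using k by (cases k) auto
  obtain c where c: "c > 0" and solve: "\<And>a b q Bi M.
    norm a \<le> \<gamma>x \<Longrightarrow> norm b \<le> \<gamma>u \<Longrightarrow> q \<in> cball 0 \<gamma>w \<Longrightarrow> bounded_linear Bi \<Longrightarrow> inj Bi \<Longrightarrow> M \<ge> 1 \<Longrightarrow>
    (\<And>y. norm (Bi y) \<le> M * norm y) \<Longrightarrow>
    (\<And>h. Bi (frechet_derivative (\<lambda>z. G z q) (at (a, b)) (0, h)) = h) \<Longrightarrow>
    \<exists>V. C_k k V \<and> (\<forall>e. norm e \<le> c / M\<^sup>2 \<longrightarrow> G (a + e, b + V e) q = G (a, b) q + \<Delta> *v e)"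
    using exact_linearizing_feedback[OF G k compact_cball[of 0 \<gamma>w]
        matrix_vector_mul_bounded_linear[of \<Delta>], where ra = \<gamma>x and rb = \<gamma>u] by blast
  define J where "J a b q = jacobian (\<lambda>u. f a u q) (at b)" for a b q
  \<comment> \<open>The maximum with 1 meets the requirement \<open>M \<ge> 1\<close> of the
    contraction argument; it is also why \<open>1 + \<beta>\<close> replaces \<open>\<beta>\<close>
    in the final radius.\<close>
  define M where "M a b q = max 1 (frobenius_norm (matrix_inv (J a b q)))" for a b q
  define P where "P a b q V \<longleftrightarrow> C_k k V \<and>
    (\<forall>e. norm e \<le> c / (M a b q)\<^sup>2 \<longrightarrow> f (a + e) (b + V e) q = f a b q + \<Delta> *v e)" for a b q V
  \<comment> \<open>One whole function of \<open>e\<close> is selected for each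
    \<open>(a, b, q)\<close>, so time enters only through these values and smoothness in
    \<open>e\<close> is preserved.\<close>
  define v where "v a b e q = (SOME V. P a b q V) e" for a b e q
  have v: "P (xd t) (ud t) (w t) (\<lambda>e. v (xd t) (ud t) e (w t))" if t: "t \<ge> 0" for t
  proof -
    define J' where "J' = matrix_inv (J (xd t) (ud t) (w t))"
    have J': "J (xd t) (ud t) (w t) ** J' = mat 1" "J' ** J (xd t) (ud t) (w t) = mat 1"
      using matrix_inv_mult[OF rank[OF t]] by (simp_all add: J'_def J_def)
    have "\<exists>V. C_k k V \<and> (\<forall>e. norm e \<le> c / (M (xd t) (ud t) (w t))\<^sup>2 \<longrightarrow>
        G (xd t + e, ud t + V e) (w t) = G (xd t, ud t) (w t) + \<Delta> *v e)"
    proof (rule solve[where Bi = "(*v) J'"])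
      show "inj ((*v) J')" using J'(1) matrix_left_invertible_injective by blast
      show "norm (J' *v y) \<le> M (xd t) (ud t) (w t) * norm y" for y
        using norm_matrix_vector_le_frobenius[of J' y]
          mult_right_mono[of "frobenius_norm J'" "M (xd t) (ud t) (w t)" "norm y"]
        by (simp add: M_def J'_def)
      fix h
      have "((\<lambda>u. (xd t, u)) has_derivative (\<lambda>h. (0, h))) (at (ud t))"
        by (auto intro!: derivative_eq_intros)
      from has_derivative_compose[OF this C_k_param_has_derivative[OF G[unfolded j]]]
      have D: "((\<lambda>u. f (xd t) u (w t)) has_derivative
          (\<lambda>h. frechet_derivative (\<lambda>z. G z (w t)) (at (xd t, ud t)) (0, h))) (at (ud t))"
        by (simp add: G_def)
      then have "((\<lambda>u. f (xd t) u (w t)) has_derivative (\<lambda>h. J (xd t) (ud t) (w t) *v h)) (at (ud t))"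
        using jacobian_works differentiableI unfolding J_def by blast
      with D have "(\<lambda>h. frechet_derivative (\<lambda>z. G z (w t)) (at (xd t, ud t)) (0, h))
          = (\<lambda>h. J (xd t) (ud t) (w t) *v h)"
        by (rule has_derivative_unique)
      then show "J' *v frechet_derivative (\<lambda>z. G z (w t)) (at (xd t, ud t)) (0, h) = h"
        using J'(2) by (metis matrix_vector_mul_assoc matrix_vector_mul_lid)
    qed (use bounds[OF t] in \<open>auto simp: M_def\<close>)
    then have "\<exists>V. P (xd t) (ud t) (w t) V" by (simp add: P_def G_def)
    then have "P (xd t) (ud t) (w t) (SOME V. P (xd t) (ud t) (w t) V)" by (rule someI_ex)
    then show ?thesis by (simp add: v_def)
  qed
  show ?thesis
  proof (rule that)
    show "c / (1 + \<beta>)\<^sup>2 > 0" using c \<beta> by simp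
    show "C_k k (\<lambda>e. v (xd t) (ud t) e (w t))" if "t \<ge> 0" for t
      using v[OF that] by (simp add: P_def)
    fix t and e :: "real^'n"
    assume t: "t \<ge> 0" and e: "norm e \<le> c / (1 + \<beta>)\<^sup>2 * exp (- (2 * \<nu>) * t)"
    have "1 \<le> exp (\<nu> * t)" using \<nu> t by simp
    then have "M (xd t) (ud t) (w t) \<le> (1 + \<beta>) * exp (\<nu> * t)"
      using inv[OF t] mult_nonneg_nonneg[of \<beta> "exp (\<nu> * t)"] \<beta>
      unfolding M_def J_def distrib_right max.bounded_iff mult_1 by (intro conjI; linarith)
    then have "(M (xd t) (ud t) (w t))\<^sup>2 \<le> ((1 + \<beta>) * exp (\<nu> * t))\<^sup>2"
      by (rule power_mono) (simp add: M_def)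
    then have "c / ((1 + \<beta>) * exp (\<nu> * t))\<^sup>2 \<le> c / (M (xd t) (ud t) (w t))\<^sup>2"
    proof (intro divide_left_mono mult_pos_pos zero_less_power)
      show "0 < M (xd t) (ud t) (w t)" by (simp add: M_def)
    qed (use c \<beta> in auto)
    moreover have "c / (1 + \<beta>)\<^sup>2 * exp (- (2 * \<nu>) * t) = c / ((1 + \<beta>) * exp (\<nu> * t))\<^sup>2"
      by (simp add: power_mult_distrib exp_minus exp_double[symmetric] divide_inverse mult_ac)
    ultimately show "f (xd t + e) (ud t + v (xd t) (ud t) e (w t)) (w t) = f (xd t) (ud t) (w t) + \<Delta> *v e"
      using v[OF t] e by (simp add: P_def)
  qed
qed

subsection \<open>Linear differential equations and the matrix exponential\<close>

lemma power_matrix_scaleR: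
  "((**) (t *\<^sub>R M) ^^ k) (mat 1) = t ^ k *\<^sub>R ((**) M ^^ k) (mat 1)" for M :: "real^'n^'n"
  by (induction k) (simp_all add: matrix_scalar_ac scalar_matrix_assoc mult.commute)

lemma norm_power_matrix_vector_le:
  "norm (((**) M ^^ k) (mat 1) *v x) \<le> onorm ((*v) M) ^ k * norm x" for M :: "real^'n^'n"
proof (induction k)
  case (Suc k)
  have bl: "bounded_linear ((*v) M)" by (rule matrix_vector_mul_bounded_linear)
  have "norm (((**) M ^^ Suc k) (mat 1) *v x) \<le> onorm ((*v) M) * norm (((**) M ^^ k) (mat 1) *v x)"
    using onorm[OF bl] by (simp add: matrix_vector_mul_assoc[symmetric])
  also have "\<dots> \<le> onorm ((*v) M) * (onorm ((*v) M) ^ k * norm x)"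
    by (intro mult_left_mono Suc.IH onorm_pos_le bl)
  finally show ?case by simp
qed simp

text \<open>Convergence has to be shown, since \<open>matrix_exp\<close> is defined by a bare
  infinite sum. An entry of a power is a component of the image of a unit vector, hence bounded by a
  power of the operator norm, and the exponential series dominates.\<close>

lemma matrix_exp_sums:
  fixes M :: "real^'n^'n"
  shows "(\<lambda>k. (t ^ k / fact k) *\<^sub>R (((**) M ^^ k) (mat 1) *v x)) sums (matrix_exp (t *\<^sub>R M) *v x)"
proof -
  define C where "C = onorm ((*v) M)"
  define P where "P k = ((**) M ^^ k) (mat 1)" for k
  have entry: "\<bar>P k $ i $ j\<bar> \<le> C ^ k" for k i j
  proof -
    have "\<bar>P k $ i $ j\<bar> = \<bar>(P k *v axis j 1) $ i\<bar>" by (simp add: matrix_vector_mul_component inner_axis)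
    also have "\<dots> \<le> norm (P k *v axis j 1)" by (rule component_le_norm_cart)
    also have "\<dots> \<le> C ^ k" using norm_power_matrix_vector_le[where M = M and k = k and x = "axis j 1"] by (simp add: P_def C_def)
    finally show ?thesis .
  qed
  have P: "norm (P k) \<le> real (CARD('n)) * (real (CARD('n)) * C ^ k)" for k
  proof -
    have "norm (P k $ i) \<le> real (CARD('n)) * C ^ k" for i
      using norm_le_l1_cart[of "P k $ i"] sum_bounded_above[of UNIV "\<lambda>j. \<bar>P k $ i $ j\<bar>"] entry
      by (metis order_trans)
    then have "(\<Sum>i\<in>UNIV. norm (P k $ i)) \<le> real (CARD('n)) * (real (CARD('n)) * C ^ k)"
      by (intro sum_bounded_above) simp
    moreover have "norm (P k) \<le> (\<Sum>i\<in>UNIV. norm (P k $ i))"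
      unfolding norm_vec_def by (rule L2_set_le_sum) simp
    ultimately show ?thesis by linarith
  qed
  have "summable (\<lambda>k. (t ^ k / fact k) *\<^sub>R P k)"
  proof (rule summable_comparison_test')
    show "summable (\<lambda>k. real (CARD('n)) * real (CARD('n)) * (inverse (fact k) * (\<bar>t\<bar> * C) ^ k))"
      by (intro summable_mult summable_exp)
    show "norm ((t ^ k / fact k) *\<^sub>R P k)
        \<le> real (CARD('n)) * real (CARD('n)) * (inverse (fact k) * (\<bar>t\<bar> * C) ^ k)" for k
      using mult_left_mono[OF P[of k], of "\<bar>t\<bar> ^ k / fact k"]
      by (simp add: abs_mult power_abs power_mult_distrib divide_inverse mult_ac)
  qed
  then have "(\<lambda>k. (t ^ k / fact k) *\<^sub>R P k) sums (\<Sum>k. (t ^ k / fact k) *\<^sub>R P k)"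
    by (rule summable_sums)
  also have "(\<Sum>k. (t ^ k / fact k) *\<^sub>R P k) = matrix_exp (t *\<^sub>R M)"
    by (simp add: matrix_exp_def power_matrix_scaleR P_def divide_inverse mult.commute)
  finally have "(\<lambda>k. ((t ^ k / fact k) *\<^sub>R P k) *v x) sums (matrix_exp (t *\<^sub>R M) *v x)"
    by (rule bounded_linear.sums[rotated])
      (simp add: linear_conv_bounded_linear[symmetric] linear_iff matrix_vector_mult_add_rdistrib
        scaleR_matrix_vector_assoc)
  then show ?thesis by (simp add: P_def scaleR_matrix_vector_assoc)
qed

lemma matrix_exp_zero: "matrix_exp (0 *\<^sub>R M) *v x = x" for M :: "real^'n^'n"
proof -
  have "(\<lambda>k. (0 ^ k / fact k) *\<^sub>R (((**) M ^^ k) (mat 1) *v x)) sums x"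
    using sums_single[of 0 "\<lambda>k. x"] by (rule back_subst[where P = "\<lambda>f. f sums x"]) auto
  then show ?thesis using matrix_exp_sums sums_unique2 by blast
qed

text \<open>Each component is an everywhere convergent real power series in \<open>t\<close> and may
  be differentiated termwise.\<close>

lemma matrix_exp_has_vector_derivative:
  fixes M :: "real^'n^'n"
  shows "((\<lambda>t. matrix_exp (t *\<^sub>R M) *v x) has_vector_derivative M *v (matrix_exp (t *\<^sub>R M) *v x)) (at t)"
proof -
  define P where "P k = ((**) M ^^ k) (mat 1) *v x" for k
  have sums: "(\<lambda>k. (t ^ k / fact k) *\<^sub>R P k) sums (matrix_exp (t *\<^sub>R M) *v x)" for t
    unfolding P_def by (rule matrix_exp_sums)
  have "((\<lambda>t. (matrix_exp (t *\<^sub>R M) *v x) $ i) has_field_derivative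
      (M *v (matrix_exp (t *\<^sub>R M) *v x)) $ i) (at t)" for i
  proof -
    define c where "c k = P k $ i / fact k" for k
    have comp: "(\<lambda>k. c k * s ^ k) sums ((matrix_exp (s *\<^sub>R M) *v x) $ i)" for s
      using sums_vec_nth[OF sums[of s], of i] by (simp add: c_def mult.commute)
    have "(\<lambda>k. (M *v ((t ^ k / fact k) *\<^sub>R P k)) $ i) sums (M *v (matrix_exp (t *\<^sub>R M) *v x)) $ i"
      by (intro sums_vec_nth bounded_linear.sums[OF matrix_vector_mul_bounded_linear] sums)
    \<comment> \<open>Applying \<open>M\<close> shifts \<open>P k\<close> to
      \<open>P (Suc k)\<close>; \<open>diffs\<close> makes the same shift, its factor
      \<open>k + 1\<close> cancelling against the factorial.\<close>
    moreover have "(M *v ((t ^ k / fact k) *\<^sub>R P k)) $ i = diffs c k * t ^ k" for k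
      by (simp add: diffs_def c_def P_def matrix_vector_mul_assoc[symmetric] matrix_vector_mult_scaleR)
    ultimately have e1: "(\<Sum>k. diffs c k * t ^ k) = (M *v (matrix_exp (t *\<^sub>R M) *v x)) $ i"
      by (simp add: sums_iff)
    have e2: "(\<Sum>k. c k * s ^ k) = (matrix_exp (s *\<^sub>R M) *v x) $ i" for s
      using comp by (simp add: sums_iff)
    have "summable (\<lambda>k. c k * s ^ k)" for s
      using comp sums_summable by blast
    from termdiffs_strong_converges_everywhere[OF this, of t] show ?thesis
      unfolding e1 e2 .
  qed
  then have comp_deriv: "((\<lambda>t. (matrix_exp (t *\<^sub>R M) *v x) $ i) has_derivative
      (\<lambda>s. (s *\<^sub>R (M *v (matrix_exp (t *\<^sub>R M) *v x))) $ i)) (at t)" for i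
    by (simp add: has_field_derivative_def mult.commute[of _ "(M *v _) $ _"])
  show ?thesis
    unfolding has_vector_derivative_def
  proof (subst has_derivative_componentwise_within, rule ballI)
    fix b :: "real^'n" assume "b \<in> Basis"
    then obtain i where b: "b = axis i 1" unfolding Basis_vec_def Basis_real_def by blast
    show "((\<lambda>t. (matrix_exp (t *\<^sub>R M) *v x) \<bullet> b) has_derivative
        (\<lambda>s. (s *\<^sub>R (M *v (matrix_exp (t *\<^sub>R M) *v x))) \<bullet> b)) (at t)"
      unfolding b cart_eq_inner_axis[symmetric] by (rule comp_deriv)
  qed
qed

lemma continuous_on_matrix_exp: "continuous_on S (\<lambda>t. matrix_exp (t *\<^sub>R M) *v x)"
  for M :: "real^'n^'n"
  by (intro continuous_at_imp_continuous_on ballI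
      has_vector_derivative_continuous[OF matrix_exp_has_vector_derivative])

text \<open>The weighted sum of squares \<open>V\<close> is a Lyapunov function: by dissipativity
  \<open>exp (2 * \<mu> * t) * V t\<close> has nonpositive derivative.\<close>

lemma weighted_dissipation_decay:
  fixes M :: "real^'n^'n" and z :: "real \<Rightarrow> real^'n"
  assumes diss: "\<And>y. (\<Sum>i\<in>UNIV. p i * (y $ i * (M *v y) $ i)) \<le> - \<mu> * (\<Sum>i\<in>UNIV. p i * (y $ i)\<^sup>2)"
    and T: "0 \<le> T" and cont: "continuous_on {0..T} z"
    and deriv: "\<And>t. 0 < t \<Longrightarrow> t < T \<Longrightarrow> (z has_vector_derivative M *v z t) (at t)"
  shows "(\<Sum>i\<in>UNIV. p i * (z T $ i)\<^sup>2) \<le> exp (- 2 * \<mu> * T) * (\<Sum>i\<in>UNIV. p i * (z 0 $ i)\<^sup>2)"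
proof -
  define V where "V t = (\<Sum>i\<in>UNIV. p i * (z t $ i)\<^sup>2)" for t
  have "exp (2 * \<mu> * T) * V T \<le> exp (2 * \<mu> * 0) * V 0"
  proof (rule DERIV_nonpos_imp_decreasing_open[OF T])
    fix t assume t: "0 < t" "t < T"
    have zi: "((\<lambda>t. z t $ i) has_real_derivative (M *v z t) $ i) (at t)" for i
      using bounded_linear.has_vector_derivative[OF bounded_linear_vec_nth deriv[OF t]]
      by (simp add: has_real_derivative_iff_has_vector_derivative)
    have "((\<lambda>t. exp (2 * \<mu> * t) * V t) has_real_derivative
        exp (2 * \<mu> * t) * (2 * \<mu>) * V t + (\<Sum>i\<in>UNIV. p i * (2 * z t $ i * (M *v z t) $ i)) * exp (2 * \<mu> * t)) (at t)"
      unfolding V_def by (auto intro!: derivative_eq_intros zi sum.cong simp: algebra_simps)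
    moreover have eq: "exp (2 * \<mu> * t) * (2 * \<mu>) * V t + (\<Sum>i\<in>UNIV. p i * (2 * z t $ i * (M *v z t) $ i)) * exp (2 * \<mu> * t)
        = 2 * exp (2 * \<mu> * t) * (\<mu> * V t + (\<Sum>i\<in>UNIV. p i * (z t $ i * (M *v z t) $ i)))"
      by (simp add: algebra_simps sum_distrib_left)
    moreover have "2 * exp (2 * \<mu> * t) * (\<mu> * V t + (\<Sum>i\<in>UNIV. p i * (z t $ i * (M *v z t) $ i))) \<le> 0"
      using diss[of "z t"] by (simp add: mult_nonneg_nonpos V_def)
    ultimately show "\<exists>y. ((\<lambda>t. exp (2 * \<mu> * t) * V t) has_real_derivative y) (at t) \<and> y \<le> 0"
      unfolding eq by blast
  next
    show "continuous_on {0..T} (\<lambda>t. exp (2 * \<mu> * t) * V t)"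
      unfolding V_def by (intro continuous_intros cont)
  qed
  then show ?thesis by (simp add: V_def exp_minus field_simps)
qed

text \<open>The weighted norm is equivalent to the Euclidean one, with the extreme weights as
  constants, whence \<open>C = sqrt (hi / lo)\<close>. Being stated for arbitrary solutions, the
  bound also yields uniqueness when applied to a difference of two solutions.\<close>

lemma dissipative_exponential_decay:
  fixes M :: "real^'n^'n"
  assumes p: "\<And>i. p i > 0"
    and diss: "\<And>y. (\<Sum>i\<in>UNIV. p i * (y $ i * (M *v y) $ i)) \<le> - \<mu> * (\<Sum>i\<in>UNIV. p i * (y $ i)\<^sup>2)"
  obtains C where "C > 0" "\<And>T z. 0 \<le> T \<Longrightarrow> continuous_on {0..T} z \<Longrightarrow>
    (\<And>t. 0 < t \<Longrightarrow> t < T \<Longrightarrow> (z has_vector_derivative M *v z t) (at t)) \<Longrightarrow>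
    norm (z T) \<le> C * exp (- \<mu> * T) * norm (z 0)"
proof -
  define lo where "lo = Min (range p)"
  define hi where "hi = Max (range p)"
  have lo: "lo > 0" "\<And>i. lo \<le> p i" using p by (auto simp: lo_def)
  have hi: "\<And>i. p i \<le> hi" by (auto simp: hi_def)
  have "hi > 0" using lo hi by (meson less_le_trans)
  have sq: "(norm y)\<^sup>2 = (\<Sum>i\<in>UNIV. (y $ i)\<^sup>2)" for y :: "real^'n"
    by (simp add: norm_vec_def L2_set_def sum_nonneg)
  have below: "lo * (norm y)\<^sup>2 \<le> (\<Sum>i\<in>UNIV. p i * (y $ i)\<^sup>2)" for y :: "real^'n"
    unfolding sq sum_distrib_left by (intro sum_mono mult_right_mono lo) auto
  have above: "(\<Sum>i\<in>UNIV. p i * (y $ i)\<^sup>2) \<le> hi * (norm y)\<^sup>2" for y :: "real^'n"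
    unfolding sq sum_distrib_left by (intro sum_mono mult_right_mono hi) auto
  show ?thesis
  proof (rule that[of "sqrt (hi / lo)"])
    show "sqrt (hi / lo) > 0" using lo \<open>hi > 0\<close> by simp
  next
    fix T and z :: "real \<Rightarrow> real^'n"
    assume z: "0 \<le> T" "continuous_on {0..T} z"
      "\<And>t. 0 < t \<Longrightarrow> t < T \<Longrightarrow> (z has_vector_derivative M *v z t) (at t)"
    have "lo * (norm (z T))\<^sup>2 \<le> exp (- 2 * \<mu> * T) * (\<Sum>i\<in>UNIV. p i * (z 0 $ i)\<^sup>2)"
      using weighted_dissipation_decay[OF diss z] below[of "z T"] by (rule order_trans[rotated])
    also have "\<dots> \<le> exp (- 2 * \<mu> * T) * (hi * (norm (z 0))\<^sup>2)"
      by (intro mult_left_mono above) auto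
    finally have "(norm (z T))\<^sup>2 \<le> exp (- 2 * \<mu> * T) * (hi * (norm (z 0))\<^sup>2) / lo"
      using lo by (simp add: field_simps)
    also have "\<dots> = (sqrt (hi / lo) * exp (- \<mu> * T) * norm (z 0))\<^sup>2"
      using lo \<open>hi > 0\<close> by (simp add: power_mult_distrib exp_double[symmetric] mult_ac)
    finally show "norm (z T) \<le> sqrt (hi / lo) * exp (- \<mu> * T) * norm (z 0)"
      using lo \<open>hi > 0\<close> by (simp add: abs_le_square_iff[symmetric] power2_le_iff_abs_le)
  qed
qed

subsection \<open>Matrices in Jordan form\<close>

lemma sum_lessThan_shift_le:
  fixes g :: "nat \<Rightarrow> real"
  assumes "\<And>i. g i \<ge> 0"
  shows "(\<Sum>i<n. if Suc i < n then g (Suc i) else 0) \<le> (\<Sum>i<n. g i)"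
proof -
  define g' where "g' i = (if i < n then g i else 0)" for i
  have "(\<Sum>i<n. if Suc i < n then g (Suc i) else 0) = (\<Sum>i<n. g' (Suc i))" by (simp add: g'_def)
  also have "\<dots> \<le> g' 0 + (\<Sum>i<n. g' (Suc i))" using assms by (simp add: g'_def)
  also have "\<dots> = (\<Sum>i<Suc n. g' i)" by (rule sum.lessThan_Suc_shift[symmetric])
  also have "\<dots> = (\<Sum>i<n. g i)" by (simp add: g'_def)
  finally show ?thesis .
qed

lemma bidiagonal_vector_mult_component:
  fixes M :: "'a::comm_ring_1^'n^'n"
  assumes h: "bij_betw h {..<CARD('n)} (UNIV :: 'n set)"
    and zero: "\<And>i j. i < CARD('n) \<Longrightarrow> j < CARD('n) \<Longrightarrow> j \<noteq> i \<Longrightarrow> j \<noteq> Suc i \<Longrightarrow> M $ h i $ h j = 0"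
    and i: "i < CARD('n)"
  shows "(M *v y) $ h i = M $ h i $ h i * y $ h i +
    (if Suc i < CARD('n) then M $ h i $ h (Suc i) * y $ h (Suc i) else 0)"
proof -
  have "(M *v y) $ h i = (\<Sum>j\<in>UNIV. M $ h i $ j * y $ j)"
    by (simp add: matrix_vector_mult_def)
  also have "\<dots> = (\<Sum>j<CARD('n). M $ h i $ h j * y $ h j)"
    by (rule sum.reindex_bij_betw[OF h, symmetric])
  also have "\<dots> = (\<Sum>j<CARD('n). (if j = i then M $ h i $ h i * y $ h i else 0) +
      (if j = Suc i then M $ h i $ h (Suc i) * y $ h (Suc i) else 0))"
    by (rule sum.cong) (use zero[OF i] in auto)
  also have "\<dots> = M $ h i $ h i * y $ h i +
      (if Suc i < CARD('n) then M $ h i $ h (Suc i) * y $ h (Suc i) else 0)"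
    using i by (simp add: sum.distrib)
  finally show ?thesis .
qed

context
  fixes \<Delta> :: "real^'n^'n" and h :: "nat \<Rightarrow> 'n"
  assumes h: "bij_betw h {..<CARD('n)} (UNIV :: 'n set)"
    and zero: "\<And>i j. i < CARD('n) \<Longrightarrow> j < CARD('n) \<Longrightarrow> j \<noteq> i \<Longrightarrow> j \<noteq> Suc i \<Longrightarrow> \<Delta> $ h i $ h j = 0"
    and super: "\<And>i. Suc i < CARD('n) \<Longrightarrow> \<Delta> $ h i $ h (Suc i) = 0 \<or>
      (\<Delta> $ h i $ h (Suc i) = 1 \<and> \<Delta> $ h i $ h i = \<Delta> $ h (Suc i) $ h (Suc i))"
begin

lemma jordan_enumerate:
  obtains i where "i < CARD('n)" "j = h i"
  using h by (metis UNIV_I bij_betw_imp_surj_on imageE lessThan_iff)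

lemma jordan_enumerate_eq: "i < CARD('n) \<Longrightarrow> j < CARD('n) \<Longrightarrow> h i = h j \<longleftrightarrow> i = j"
  using h by (auto simp: bij_betw_def inj_on_def)

text \<open>At the first coordinate of a block the column has only its diagonal entry, so the unit
  vector is an eigenvector; inside a block the diagonal entry equals the preceding one.\<close>

lemma jordan_diagonal_eigenvalue:
  "i < CARD('n) \<Longrightarrow> complex_of_real (\<Delta> $ h i $ h i) \<in> eigenvalues (complex_matrix \<Delta>)"
proof (induction i)
  have axis: "complex_of_real (\<Delta> $ h i $ h i) \<in> eigenvalues (complex_matrix \<Delta>)"
    if i: "i < CARD('n)" and above: "\<And>j. j < CARD('n) \<Longrightarrow> j \<noteq> i \<Longrightarrow> \<Delta> $ h j $ h i = 0" for i
  proof -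
    have "complex_matrix \<Delta> *v axis (h i) 1 = complex_of_real (\<Delta> $ h i $ h i) *s axis (h i) 1"
    proof (rule vec_eq_iff[THEN iffD2, rule_format])
      fix l
      obtain j where "j < CARD('n)" "l = h j" by (rule jordan_enumerate)
      then show "(complex_matrix \<Delta> *v axis (h i) 1) $ l = (complex_of_real (\<Delta> $ h i $ h i) *s axis (h i) 1) $ l"
        using above[of j] i jordan_enumerate_eq[of i j]
        by (auto simp: complex_matrix_def matrix_vector_mult_def axis_def if_distrib cong: if_cong)
    qed
    then show ?thesis unfolding eigenvalues_def by (auto intro!: exI[of _ "axis (h i) 1"])
  qed
  {
    case 0
    then show ?case using zero by (intro axis) auto
  next
    case (Suc i)
    show ?case
    proof (cases "\<Delta> $ h i $ h (Suc i) = 0")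
      case True
      then show ?thesis using zero Suc.prems by (intro axis) (metis Suc_inject)+
    next
      case False
      then show ?thesis using super[of i] Suc by simp
    qed
  }
qed

text \<open>At the last nonzero coordinate of an eigenvector the superdiagonal term vanishes,
  leaving the diagonal entry as eigenvalue. The inclusion makes the spectrum finite, which
  \<open>Max\<close> needs.\<close>

lemma jordan_eigenvalues_subset:
  "eigenvalues (complex_matrix \<Delta>) \<subseteq> (\<lambda>i. complex_of_real (\<Delta> $ h i $ h i)) ` {..<CARD('n)}"
proof
  fix l assume "l \<in> eigenvalues (complex_matrix \<Delta>)"
  then obtain v where v: "v \<noteq> 0" "complex_matrix \<Delta> *v v = l *s v" by (auto simp: eigenvalues_def)
  define I where "I = {i. i < CARD('n) \<and> v $ h i \<noteq> 0}"
  obtain j where "v $ j \<noteq> 0" using v(1) by (auto simp: vec_eq_iff)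
  then have "I \<noteq> {}" using jordan_enumerate[of j] by (auto simp: I_def)
  moreover have "finite I" by (simp add: I_def)
  ultimately have m: "Max I \<in> I" and "\<And>i. i \<in> I \<Longrightarrow> i \<le> Max I" by auto
  then have last: "Suc (Max I) < CARD('n) \<Longrightarrow> v $ h (Suc (Max I)) = 0"
    by (metis (mono_tags, lifting) I_def Suc_n_not_le_n mem_Collect_eq)
  have "(complex_matrix \<Delta> *v v) $ h (Max I) = complex_of_real (\<Delta> $ h (Max I) $ h (Max I)) * v $ h (Max I)"
    using m last zero by (subst bidiagonal_vector_mult_component[OF h]) (auto simp: I_def complex_matrix_def)
  then have "l = complex_of_real (\<Delta> $ h (Max I) $ h (Max I))"
    using v(2) m by (simp add: I_def)
  then show "l \<in> (\<lambda>i. complex_of_real (\<Delta> $ h i $ h i)) ` {..<CARD('n)}"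
    using m by (auto simp: I_def)
qed

lemma jordan_diagonal_le:
  assumes "i < CARD('n)"
  shows "\<Delta> $ h i $ h i \<le> Max (Re ` eigenvalues (complex_matrix \<Delta>))"
proof (rule Max_ge)
  show "finite (Re ` eigenvalues (complex_matrix \<Delta>))"
    using jordan_eigenvalues_subset finite_subset by blast
  show "\<Delta> $ h i $ h i \<in> Re ` eigenvalues (complex_matrix \<Delta>)"
    using jordan_diagonal_eigenvalue[OF assms] by force
qed

text \<open>
  Weighting the \<open>i\<close>-th coordinate by \<open>s\<^sup>i\<close> turns the ones on the superdiagonal into \<open>1 / s\<close>.
\<close>

lemma jordan_weighted_dissipation:
  fixes s :: real
  assumes s: "s > 0"
  defines "p \<equiv> \<lambda>j. (s ^ the_inv_into {..<CARD('n)} h j)\<^sup>2"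
  shows "(\<Sum>j\<in>UNIV. p j * (y $ j * (\<Delta> *v y) $ j))
    \<le> (Max (Re ` eigenvalues (complex_matrix \<Delta>)) + 1 / s) * (\<Sum>j\<in>UNIV. p j * (y $ j)\<^sup>2)"
proof -
  define m where "m = Max (Re ` eigenvalues (complex_matrix \<Delta>))"
  define g where "g i = (s ^ i * y $ h i)\<^sup>2" for i
  have p: "p (h i) = (s ^ i)\<^sup>2" if "i < CARD('n)" for i
    using h that by (simp add: p_def the_inv_into_f_f bij_betw_def)
  have V: "(\<Sum>j\<in>UNIV. p j * (y $ j)\<^sup>2) = (\<Sum>i<CARD('n). g i)"
    unfolding sum.reindex_bij_betw[OF h, symmetric, where g = "\<lambda>j. p j * (y $ j)\<^sup>2"]
    by (rule sum.cong) (simp_all add: p g_def power_mult_distrib)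
  have "(\<Sum>j\<in>UNIV. p j * (y $ j * (\<Delta> *v y) $ j)) = (\<Sum>i<CARD('n). p (h i) * (y $ h i * (\<Delta> *v y) $ h i))"
    by (rule sum.reindex_bij_betw[OF h, symmetric])
  \<comment> \<open>A superdiagonal 1 couples neighbouring coordinates at cost
    \<open>1 / (2 * s)\<close> on each side. Every \<open>g i\<close> is charged at most twice,
    hence \<open>1 / s\<close> in the end.\<close>
  also have "\<dots> \<le> (\<Sum>i<CARD('n). m * g i + 1 / (2 * s) * (g i + (if Suc i < CARD('n) then g (Suc i) else 0)))"
  proof (rule sum_mono)
    fix i assume "i \<in> {..<CARD('n)}"
    then have i: "i < CARD('n)" by simp
    have d: "\<Delta> $ h i $ h i * g i \<le> m * g i"
      unfolding m_def by (intro mult_right_mono jordan_diagonal_le i) (simp add: g_def)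
    have comp: "(\<Delta> *v y) $ h i = \<Delta> $ h i $ h i * y $ h i +
        (if Suc i < CARD('n) then \<Delta> $ h i $ h (Suc i) * y $ h (Suc i) else 0)"
      by (rule bidiagonal_vector_mult_component[OF h zero i])
    show "p (h i) * (y $ h i * (\<Delta> *v y) $ h i)
        \<le> m * g i + 1 / (2 * s) * (g i + (if Suc i < CARD('n) then g (Suc i) else 0))"
    proof (cases "Suc i < CARD('n) \<and> \<Delta> $ h i $ h (Suc i) = 1")
      case True
      define A where "A = s ^ i * y $ h i"
      define B where "B = s ^ Suc i * y $ h (Suc i)"
      have g: "g i = A\<^sup>2" "g (Suc i) = B\<^sup>2" by (simp_all only: g_def A_def B_def)
      have "p (h i) * (y $ h i * (\<Delta> *v y) $ h i) = \<Delta> $ h i $ h i * g i + 1 / s * (A * B)"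
        using True s by (simp add: comp p[OF i] g_def A_def B_def power2_eq_square field_simps)
      also have "1 / s * (A * B) \<le> 1 / s * ((A\<^sup>2 + B\<^sup>2) / 2)"
        using s sum_squares_bound[of A B] by (intro mult_left_mono) auto
      finally show ?thesis using d True by (simp add: g)
    next
      case False
      then have "p (h i) * (y $ h i * (\<Delta> *v y) $ h i) = \<Delta> $ h i $ h i * g i"
        using super[of i] by (auto simp: comp p[OF i] g_def power2_eq_square)
      moreover have "0 \<le> 1 / (2 * s) * (g i + (if Suc i < CARD('n) then g (Suc i) else 0))"
        using s by (intro mult_nonneg_nonneg) (auto simp: g_def)
      ultimately show ?thesis using d by linarith
    qed
  qed
  also have "\<dots> = m * (\<Sum>i<CARD('n). g i) + 1 / (2 * s) *
      ((\<Sum>i<CARD('n). g i) + (\<Sum>i<CARD('n). if Suc i < CARD('n) then g (Suc i) else 0))"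
    by (simp only: sum.distrib sum_distrib_left[symmetric])
  also have "\<dots> \<le> m * (\<Sum>i<CARD('n). g i) + 1 / (2 * s) * ((\<Sum>i<CARD('n). g i) + (\<Sum>i<CARD('n). g i))"
    using s by (intro add_left_mono mult_left_mono sum_lessThan_shift_le) (auto simp: g_def)
  also have "\<dots> = (m + 1 / s) * (\<Sum>i<CARD('n). g i)" using s by (simp add: field_simps)
  finally show ?thesis by (simp add: m_def V)
qed

end

lemma jordan_canonical_form_dissipative:
  fixes \<Delta> :: "real^'n^'n"
  assumes J: "jordan_canonical_form \<Delta>" and \<mu>: "Max (Re ` eigenvalues (complex_matrix \<Delta>)) < - \<mu>"
  obtains p :: "'n \<Rightarrow> real" where "\<And>i. p i > 0"
    "\<And>y. (\<Sum>i\<in>UNIV. p i * (y $ i * (\<Delta> *v y) $ i)) \<le> - \<mu> * (\<Sum>i\<in>UNIV. p i * (y $ i)\<^sup>2)"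
proof -
  obtain h where h: "bij_betw h {..<CARD('n)} (UNIV :: 'n set)"
    and J': "\<forall>i<CARD('n). \<forall>j<CARD('n).
          (j \<noteq> i \<and> j \<noteq> Suc i \<longrightarrow> \<Delta> $ h i $ h j = 0) \<and>
          (j = Suc i \<longrightarrow>
             \<Delta> $ h i $ h j = 0 \<or> (\<Delta> $ h i $ h j = 1 \<and> \<Delta> $ h i $ h i = \<Delta> $ h j $ h j))"
    using J unfolding jordan_canonical_form_def by blast
  \<comment> \<open>The rescaled superdiagonal costs exactly the gap between the spectral bound and
    \<open>- \<mu>\<close>.\<close>
  define s where "s = 1 / (- \<mu> - Max (Re ` eigenvalues (complex_matrix \<Delta>)))"
  have s: "s > 0" "Max (Re ` eigenvalues (complex_matrix \<Delta>)) + 1 / s = - \<mu>" using \<mu> by (auto simp: s_def)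
  show ?thesis
  proof (rule that)
    show "(s ^ the_inv_into {..<CARD('n)} h i)\<^sup>2 > 0" for i using s(1) by simp
    show "(\<Sum>i\<in>UNIV. (s ^ the_inv_into {..<CARD('n)} h i)\<^sup>2 * (y $ i * (\<Delta> *v y) $ i))
        \<le> - \<mu> * (\<Sum>i\<in>UNIV. (s ^ the_inv_into {..<CARD('n)} h i)\<^sup>2 * (y $ i)\<^sup>2)" for y
      unfolding s(2)[symmetric]
      by (rule jordan_weighted_dissipation[OF h _ _ s(1)]) (use J' in auto)
  qed
qed

subsection \<open>The closed loop\<close>

text \<open>The times in \<open>{0..t}\<close> with nonnegative value form a nonempty compact set,
  which has a least element.\<close>

lemma first_exit_time:
  fixes g :: "real \<Rightarrow> real"
  assumes cont: "continuous_on {0..t} g" and t: "0 \<le> t" "g t \<ge> 0"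
  obtains T where "0 \<le> T" "T \<le> t" "g T \<ge> 0" "\<And>s. 0 \<le> s \<Longrightarrow> s < T \<Longrightarrow> g s < 0"
proof -
  define Z where "Z = {0..t} \<inter> g -` {0..}"
  have "closed Z" unfolding Z_def by (intro continuous_closed_preimage cont) auto
  moreover have "bounded Z" by (rule bounded_subset[of "{0..t}"]) (auto simp: Z_def)
  ultimately have "compact Z" by (simp add: compact_eq_bounded_closed)
  moreover have "Z \<noteq> {}" using t by (auto simp: Z_def)
  ultimately obtain T where "T \<in> Z" "\<And>s. s \<in> Z \<Longrightarrow> T \<le> s"
    using compact_attains_inf[of Z] by blast
  then show ?thesis by (intro that[of T]) (force simp: Z_def)+
qed

context
  fixes f :: "real^'n \<Rightarrow> real^'m \<Rightarrow> real^'p \<Rightarrow> real^'n"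
    and xd :: "real \<Rightarrow> real^'n" and ud :: "real \<Rightarrow> real^'m" and w :: "real \<Rightarrow> real^'p"
    and v :: "real^'n \<Rightarrow> real^'m \<Rightarrow> real^'n \<Rightarrow> real^'p \<Rightarrow> real^'m"
    and \<Delta> :: "real^'n^'n" and C \<mu> \<sigma> c :: real
  assumes xd: "is_solution f ud w xd"
    and C: "C > 0"
    and decay: "\<And>T z. 0 \<le> T \<Longrightarrow> continuous_on {0..T} z \<Longrightarrow>
      (\<And>t. 0 < t \<Longrightarrow> t < T \<Longrightarrow> (z has_vector_derivative \<Delta> *v z t) (at t)) \<Longrightarrow>
      norm (z T) \<le> C * exp (- \<mu> * T) * norm (z 0)"
    and exact: "\<And>t e. t \<ge> 0 \<Longrightarrow> norm e \<le> c * exp (- \<sigma> * t) \<Longrightarrow>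
      f (xd t + e) (ud t + v (xd t) (ud t) e (w t)) (w t) = f (xd t) (ud t) (w t) + \<Delta> *v e"
    and rate: "\<sigma> \<le> \<mu>" "\<mu> > 0" and c: "c > 0"
begin

lemma matrix_exp_decay:
  assumes "0 \<le> t"
  shows "norm (matrix_exp (t *\<^sub>R \<Delta>) *v e) \<le> C * exp (- \<mu> * t) * norm e"
proof -
  have "norm (matrix_exp (t *\<^sub>R \<Delta>) *v e)
      \<le> C * exp (- \<mu> * t) * norm (matrix_exp (0 *\<^sub>R \<Delta>) *v e)"
    by (rule decay[where z = "\<lambda>t. matrix_exp (t *\<^sub>R \<Delta>) *v e", OF assms])
      (rule continuous_on_matrix_exp matrix_exp_has_vector_derivative)+
  then show ?thesis by (simp only: matrix_exp_zero)
qed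

text \<open>The radius \<open>c / C\<close> leaves room for a transient growth by the factor
  \<open>C\<close>; afterwards \<open>\<sigma> \<le> \<mu>\<close> makes the flow decay at least as
  fast as the tube.\<close>

lemma matrix_exp_in_tube:
  assumes "0 \<le> t" and e: "norm e < c / C"
  shows "norm (matrix_exp (t *\<^sub>R \<Delta>) *v e) < c * exp (- \<sigma> * t)"
proof -
  have "norm (matrix_exp (t *\<^sub>R \<Delta>) *v e) \<le> C * norm e * exp (- \<mu> * t)"
    using matrix_exp_decay[OF assms(1), of e] by (simp add: mult_ac)
  also have "\<dots> < c * exp (- \<mu> * t)" using e C by (simp add: field_simps)
  also have "\<dots> \<le> c * exp (- \<sigma> * t)" using c rate assms(1) by (simp add: mult_right_mono)
  finally show ?thesis .
qed

text \<open>
  While the error stays in the shrinking tube \<open>norm e < c * exp (- \<sigma> * t)\<close>, it obeys the linear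
  equation and hence decays faster than the tube, which it therefore never leaves.
\<close>

lemma closed_loop_error:
  assumes x: "closed_loop_solution f xd ud w v x" and x0: "norm (x 0 - xd 0) < c / C" and t0: "0 \<le> t"
  shows "x t - xd t = matrix_exp (t *\<^sub>R \<Delta>) *v (x 0 - xd 0)"
proof -
  define e where "e t = x t - xd t" for t
  define E where "E t = matrix_exp (t *\<^sub>R \<Delta>) *v e 0" for t
  define F where "F = (\<lambda>s. f (x s) (ud s + v (xd s) (ud s) (e s) (w s)) (w s))"
  define F0 where "F0 = (\<lambda>s. f (xd s) (ud s) (w s))"
  define \<phi> where "\<phi> = (\<lambda>s. F s - F0 s)"
  have F: "F integrable_on {0..t}" "x t = x 0 + integral {0..t} F" if "0 \<le> t" for t
  proof -
    have "F absolutely_integrable_on {0..t} \<and> x t = x 0 + integral {0..t} F"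
      using x that unfolding closed_loop_solution_def is_solution_def F_def e_def by blast
    then show "F integrable_on {0..t}" "x t = x 0 + integral {0..t} F"
      by (simp_all add: set_lebesgue_integral_eq_integral(1))
  qed
  have F0: "F0 integrable_on {0..t}" "xd t = xd 0 + integral {0..t} F0" if "0 \<le> t" for t
  proof -
    have "F0 absolutely_integrable_on {0..t} \<and> xd t = xd 0 + integral {0..t} F0"
      using xd that unfolding is_solution_def F0_def by blast
    then show "F0 integrable_on {0..t}" "xd t = xd 0 + integral {0..t} F0"
      by (simp_all add: set_lebesgue_integral_eq_integral(1))
  qed
  have \<phi>_int: "\<phi> integrable_on {0..t}" if "0 \<le> t" for t
    unfolding \<phi>_def using F F0 that by (intro integrable_diff) auto
  have e_eq: "e t = e 0 + integral {0..t} \<phi>" if "0 \<le> t" for t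
    unfolding \<phi>_def using F(2)[OF that] F0(2)[OF that] integral_diff[OF F(1)[OF that] F0(1)[OF that]]
    by (simp add: e_def)
  have e_cont: "continuous_on {0..t} e" if "0 \<le> t" for t
  proof -
    have "continuous_on {0..t} (\<lambda>t. e 0 + integral {0..t} \<phi>)"
      by (intro continuous_intros indefinite_integral_continuous_1 \<phi>_int that)
    then show ?thesis by (rule continuous_on_eq) (rule e_eq[symmetric], simp)
  qed
  \<comment> \<open>The tube condition is required only before \<open>T\<close>, so that the
    conclusion is available at the first exit time itself.\<close>
  have linear: "e T = E T"
    if T: "0 \<le> T" and tube: "\<And>s. 0 \<le> s \<Longrightarrow> s < T \<Longrightarrow> norm (e s) < c * exp (- \<sigma> * s)" for T
  proof -
    have \<phi>_eq: "\<phi> s = \<Delta> *v e s" if "0 \<le> s" "s < T" for s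
      using exact[OF that(1), of "e s"] tube[OF that] by (simp add: \<phi>_def F_def F0_def e_def)
    have \<Delta>e_cont: "continuous_on {0..T} (\<lambda>s. \<Delta> *v e s)"
      using bounded_linear.continuous_on[OF matrix_vector_mul_bounded_linear e_cont[OF T]] .
    have e_int: "e u = e 0 + integral {0..u} (\<lambda>s. \<Delta> *v e s)" if u: "u \<in> {0..T}" for u
    proof -
      \<comment> \<open>The identity for the integrand may fail at \<open>T\<close>, a null
        set.\<close>
      have "integral {0..u} (\<lambda>s. \<Delta> *v e s) = integral {0..u} \<phi>"
        by (rule integral_spike[of "{T}"]) (use u \<phi>_eq in auto)
      then show ?thesis using e_eq[of u] u by simp
    qed
    \<comment> \<open>The error is a priori only a Caratheodory solution; with a continuous
      integrand it becomes classically differentiable.\<close>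
    have e_deriv: "(e has_vector_derivative \<Delta> *v e s) (at s)" if s: "0 < s" "s < T" for s
    proof -
      have "((\<lambda>u. e 0 + integral {0..u} (\<lambda>s. \<Delta> *v e s)) has_vector_derivative 0 + \<Delta> *v e s) (at s within {0..T})"
        using s by (intro has_vector_derivative_add has_vector_derivative_const
            integral_has_vector_derivative \<Delta>e_cont) auto
      then have "(e has_vector_derivative 0 + \<Delta> *v e s) (at s within {0..T})"
        using s by (intro has_vector_derivative_transform[OF _ e_int]) auto
      then show ?thesis using s by (simp add: at_within_Icc_at)
    qed
    \<comment> \<open>The difference solves the linear equation with initial value 0, and decay
      forces it to vanish.\<close>
    have "norm (e T - E T) \<le> C * exp (- \<mu> * T) * norm (e 0 - E 0)"
    proof (rule decay[OF T])
      show "continuous_on {0..T} (\<lambda>t. e t - E t)"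
        unfolding E_def by (intro continuous_on_diff e_cont T continuous_on_matrix_exp)
      show "((\<lambda>t. e t - E t) has_vector_derivative \<Delta> *v (e s - E s)) (at s)" if "0 < s" "s < T" for s
        unfolding matrix_vector_mult_diff_distrib E_def
        by (intro has_vector_derivative_diff e_deriv that matrix_exp_has_vector_derivative)
    qed
    moreover have "E 0 = e 0" unfolding E_def by (rule matrix_exp_zero)
    ultimately show ?thesis by simp
  qed
  have "norm (e s) < c * exp (- \<sigma> * s)" if s: "0 \<le> s" for s
  proof (rule ccontr)
    assume "\<not> norm (e s) < c * exp (- \<sigma> * s)"
    then have nonneg: "norm (e s) - c * exp (- \<sigma> * s) \<ge> 0" by simp
    have cont: "continuous_on {0..s} (\<lambda>s. norm (e s) - c * exp (- \<sigma> * s))"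
      by (intro continuous_intros e_cont s)
    obtain T where T: "0 \<le> T" "T \<le> s" "norm (e T) - c * exp (- \<sigma> * T) \<ge> 0"
      "\<And>s. 0 \<le> s \<Longrightarrow> s < T \<Longrightarrow> norm (e s) - c * exp (- \<sigma> * s) < 0"
      using first_exit_time[OF cont s nonneg] by blast
    \<comment> \<open>Linear up to the first exit, the error is strictly inside the tube at
      \<open>T\<close>, contradicting the exit.\<close>
    then have "e T = E T" by (intro linear T(1)) simp
    then show False
      using matrix_exp_in_tube[OF T(1) x0] T(3) by (simp add: E_def e_def)
  qed
  then have "e t = E t" by (intro linear t0) auto
  then show ?thesis by (simp add: E_def e_def)
qed

text \<open>The linear error never leaves the tube, so the closed-loop integrand equals the
  reference integrand plus a continuous function and is integrable without any regularity of
  \<open>v\<close>.\<close>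

lemma closed_loop_solution_exists:
  assumes e: "norm e < c / C"
  shows "closed_loop_solution f xd ud w v (\<lambda>t. xd t + matrix_exp (t *\<^sub>R \<Delta>) *v e)"
  unfolding closed_loop_solution_def is_solution_def
proof (intro allI impI)
  fix t :: real assume t: "0 \<le> t"
  define E where "E t = matrix_exp (t *\<^sub>R \<Delta>) *v e" for t
  define F where "F = (\<lambda>s. f (xd s + E s) (ud s + v (xd s) (ud s) (xd s + E s - xd s) (w s)) (w s))"
  define F0 where "F0 = (\<lambda>s. f (xd s) (ud s) (w s))"
  have F_eq: "F s = F0 s + \<Delta> *v E s" if "0 \<le> s" for s
    using exact[OF that, of "E s"] matrix_exp_in_tube[OF that e] by (simp add: F_def F0_def E_def)
  have F0: "F0 absolutely_integrable_on {0..t}" "xd t = xd 0 + integral {0..t} F0"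
    using xd t unfolding is_solution_def F0_def by blast+
  have "continuous_on {0..t} (\<lambda>s. \<Delta> *v E s)"
    unfolding E_def by (rule bounded_linear.continuous_on[OF matrix_vector_mul_bounded_linear continuous_on_matrix_exp])
  then have \<Delta>E: "(\<lambda>s. \<Delta> *v E s) absolutely_integrable_on {0..t}"
    by (rule absolutely_integrable_continuous_real)
  have "((\<lambda>s. \<Delta> *v E s) has_integral E t - E 0) {0..t}"
    unfolding E_def
    by (rule fundamental_theorem_of_calculus[OF t
          has_vector_derivative_at_within[OF matrix_exp_has_vector_derivative]])
  then have int_E: "integral {0..t} (\<lambda>s. \<Delta> *v E s) = E t - E 0" by (rule integral_unique)
  have "(\<lambda>s. F0 s + \<Delta> *v E s) absolutely_integrable_on {0..t}"
    by (intro set_integral_add F0 \<Delta>E)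
  then have "F absolutely_integrable_on {0..t}"
    by (rule absolutely_integrable_spike[where S = "{}"]) (use F_eq in auto)
  moreover have "integral {0..t} F = integral {0..t} F0 + (E t - E 0)"
  proof -
    have "integral {0..t} F = integral {0..t} (\<lambda>s. F0 s + \<Delta> *v E s)"
      by (rule integral_cong) (use F_eq in auto)
    also have "\<dots> = integral {0..t} F0 + integral {0..t} (\<lambda>s. \<Delta> *v E s)"
      using F0(1) \<Delta>E by (intro integral_add set_lebesgue_integral_eq_integral(1)) auto
    finally show ?thesis by (simp add: int_E)
  qed
  ultimately show "(\<lambda>s. f (xd s + matrix_exp (s *\<^sub>R \<Delta>) *v e)
          (ud s + v (xd s) (ud s) (xd s + matrix_exp (s *\<^sub>R \<Delta>) *v e - xd s) (w s)) (w s))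
        absolutely_integrable_on {0..t} \<and>
      xd t + matrix_exp (t *\<^sub>R \<Delta>) *v e = xd 0 + matrix_exp (0 *\<^sub>R \<Delta>) *v e +
        integral {0..t} (\<lambda>s. f (xd s + matrix_exp (s *\<^sub>R \<Delta>) *v e)
          (ud s + v (xd s) (ud s) (xd s + matrix_exp (s *\<^sub>R \<Delta>) *v e - xd s) (w s)) (w s))"
    using F0(2) unfolding F_def E_def by simp
qed

text \<open>Uniqueness and decay both follow from the explicit formula that every solution starting
  within \<open>c / C\<close> obeys.\<close>

lemma closed_loop_exponentially_stable:
  "exponentially_stable_within (closed_loop_solution f xd ud w v) xd (c / C)"
  unfolding exponentially_stable_within_def
proof (intro conjI allI impI)
  fix x0 assume x0: "norm (x0 - xd 0) < c / C"
  show "unique_solution_from (closed_loop_solution f xd ud w v) x0"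
    unfolding unique_solution_from_def
  proof (intro conjI allI impI exI)
    show "closed_loop_solution f xd ud w v (\<lambda>t. xd t + matrix_exp (t *\<^sub>R \<Delta>) *v (x0 - xd 0))"
      by (rule closed_loop_solution_exists[OF x0])
    show "xd 0 + matrix_exp (0 *\<^sub>R \<Delta>) *v (x0 - xd 0) = x0"
      unfolding matrix_exp_zero by simp
  next
    fix x y t
    assume xy: "closed_loop_solution f xd ud w v x \<and> closed_loop_solution f xd ud w v y \<and> x 0 = x0 \<and> y 0 = x0"
      and t: "(0::real) \<le> t"
    have "x t - xd t = y t - xd t"
      using closed_loop_error[of x t] closed_loop_error[of y t] xy x0 t by simp
    then show "x t = y t" by simp
  qed
next
  have bound: "norm (x t - xd t) \<le> C * exp (- \<mu> * t) * norm (x 0 - xd 0)"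
    if "closed_loop_solution f xd ud w v x \<and> norm (x 0 - xd 0) < c / C" "0 \<le> t" for x t
    using that closed_loop_error[of x t] matrix_exp_decay[of t "x 0 - xd 0"] by simp
  then show "\<exists>M>0. \<exists>\<mu>>0. \<forall>x. closed_loop_solution f xd ud w v x \<and> norm (x 0 - xd 0) < c / C \<longrightarrow>
      (\<forall>t\<ge>0. norm (x t - xd t) \<le> M * exp (- \<mu> * t) * norm (x 0 - xd 0))"
    using C rate(2) by blast
  fix x assume x: "closed_loop_solution f xd ud w v x \<and> norm (x 0 - xd 0) < c / C"
  have "((\<lambda>t. exp (- \<mu> * t)) \<longlongrightarrow> 0) at_top"
    using rate(2) by (intro filterlim_compose[OF exp_at_bot]
        filterlim_tendsto_neg_mult_at_bot[OF tendsto_const _ filterlim_ident]) auto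
  then have "((\<lambda>t. C * exp (- \<mu> * t) * norm (x 0 - xd 0)) \<longlongrightarrow> 0) at_top"
    by (intro tendsto_mult_left_zero tendsto_mult_right_zero)
  then show "((\<lambda>t. x t - xd t) \<longlongrightarrow> 0) at_top"
    by (rule Lim_null_comparison[rotated])
      (rule eventually_mono[OF eventually_ge_at_top[of 0]], rule bound[OF x])
qed

end

theorem theorem1:
  fixes f :: "real^'n \<Rightarrow> real^'n \<Rightarrow> real^'p \<Rightarrow> real^'n"
    and x\<^sub>d u\<^sub>d :: "real \<Rightarrow> real^'n"
    and w :: "real \<Rightarrow> real^'p"
    and A B :: "real \<Rightarrow> real^'n^'n"
    and k :: nat
    and \<gamma>\<^sub>x \<gamma>\<^sub>u \<gamma>\<^sub>w \<beta>\<^sub>1 \<beta>\<^sub>2 \<beta>\<^sub>3 \<nu> \<alpha> \<kappa> :: real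
  assumes k_ge_2: "k \<ge> 2"
    and f_C_k: "C_k_param k (\<lambda>(x, u) q. f x u q)"
    and f_continuous: "continuous_on UNIV (\<lambda>(x, u, q). f x u q)"
    and w_measurable: "w \<in> borel_measurable (lebesgue_on {0..})"
    and well_posed: "\<And>u x0. admissible_input u \<Longrightarrow> unique_solution_from (is_solution f u w) x0"
    and u_d_input: "admissible_input u\<^sub>d"
    and x_d_solution: "is_solution f u\<^sub>d w x\<^sub>d"
    and A_eq: "\<And>t. A t = jacobian (\<lambda>x. f x (u\<^sub>d t) (w t)) (at (x\<^sub>d t))"
    and B_eq: "\<And>t. B t = jacobian (\<lambda>u. f (x\<^sub>d t) u (w t)) (at (u\<^sub>d t))"
    and A1_consts: "\<gamma>\<^sub>x \<ge> 0" "\<gamma>\<^sub>u \<ge> 0" "\<gamma>\<^sub>w \<ge> 0"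
    and A1: "\<And>t. t \<ge> 0 \<Longrightarrow> norm (x\<^sub>d t) \<le> \<gamma>\<^sub>x \<and> norm (u\<^sub>d t) \<le> \<gamma>\<^sub>u \<and> norm (w t) \<le> \<gamma>\<^sub>w"
    and A2: "\<And>t. t \<ge> 0 \<Longrightarrow> rank (B t) = CARD('n)"
    and A3_consts: "\<beta>\<^sub>1 > 0" "\<nu> \<ge> 0"
    and A3: "\<And>t. t \<ge> 0 \<Longrightarrow> frobenius_norm (matrix_inv (B t)) \<le> \<beta>\<^sub>1 * exp (\<nu> * t)"
    and A4_consts: "\<beta>\<^sub>2 \<ge> 0"
    and A4: "\<And>t. t \<ge> 0 \<Longrightarrow> frobenius_norm (matrix_inv (B t) ** A t) \<le> \<beta>\<^sub>2 * exp (\<nu> * t)"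
    and A5_consts: "\<alpha> > 0" "\<beta>\<^sub>3 \<ge> 0" "\<kappa> > 0"
    and A5: "\<And>t e. t \<ge> 0 \<Longrightarrow> norm e \<le> \<kappa> \<Longrightarrow>
      norm (f (e + x\<^sub>d t) (u\<^sub>d t) (w t) - f (x\<^sub>d t) (u\<^sub>d t) (w t) - A t *v e)
        \<le> \<beta>\<^sub>3 * norm e powr \<alpha>"
  shows "(\<exists>v :: real^'n \<Rightarrow> real^'n \<Rightarrow> real^'n \<Rightarrow> real^'p \<Rightarrow> real^'n.
            (\<forall>t\<ge>0. C_k k (\<lambda>e. v (x\<^sub>d t) (u\<^sub>d t) e (w t))) \<and>
            (\<exists>\<delta>>0. exponentially_stable_within (closed_loop_solution f x\<^sub>d u\<^sub>d w v) x\<^sub>d \<delta>))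
       \<and> (\<forall>\<Delta> :: real^'n^'n.
            hurwitz (complex_matrix \<Delta>) \<and> semi_simple (complex_matrix \<Delta>) \<and>
            eigenvalues (complex_matrix \<Delta>) \<subseteq> \<real> \<and> jordan_canonical_form \<Delta> \<and>
            2 * max (\<nu> / \<alpha>) \<nu> + Max (Re ` eigenvalues (complex_matrix \<Delta>)) < 0 \<longrightarrow>
            (\<exists>v :: real^'n \<Rightarrow> real^'n \<Rightarrow> real^'n \<Rightarrow> real^'p \<Rightarrow> real^'n.
              (\<forall>t\<ge>0. C_k k (\<lambda>e. v (x\<^sub>d t) (u\<^sub>d t) e (w t))) \<and>
              (\<exists>\<delta>>0. exponentially_stable_within (closed_loop_solution f x\<^sub>d u\<^sub>d w v) x\<^sub>d \<delta> \<and>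
                 (\<forall>x. closed_loop_solution f x\<^sub>d u\<^sub>d w v x \<and> norm (x 0 - x\<^sub>d 0) < \<delta> \<longrightarrow>
                    (\<forall>t\<ge>0. x t - x\<^sub>d t = matrix_exp (t *\<^sub>R \<Delta>) *v (x 0 - x\<^sub>d 0))))))"
proof -
  \<comment> \<open>Stated for dissipative matrices, so that one argument covers both a scalar
    matrix and the Jordan matrices of the second claim.\<close>
  have main: "\<exists>v :: real^'n \<Rightarrow> real^'n \<Rightarrow> real^'n \<Rightarrow> real^'p \<Rightarrow> real^'n.
      (\<forall>t\<ge>0. C_k k (\<lambda>e. v (x\<^sub>d t) (u\<^sub>d t) e (w t))) \<and>
      (\<exists>\<delta>>0. exponentially_stable_within (closed_loop_solution f x\<^sub>d u\<^sub>d w v) x\<^sub>d \<delta> \<and>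
        (\<forall>x. closed_loop_solution f x\<^sub>d u\<^sub>d w v x \<and> norm (x 0 - x\<^sub>d 0) < \<delta> \<longrightarrow>
          (\<forall>t\<ge>0. x t - x\<^sub>d t = matrix_exp (t *\<^sub>R \<Delta>) *v (x 0 - x\<^sub>d 0))))"
    if p: "\<And>i. p i > 0"
      and diss: "\<And>y. (\<Sum>i\<in>UNIV. p i * (y $ i * (\<Delta> *v y) $ i)) \<le> - \<mu> * (\<Sum>i\<in>UNIV. p i * (y $ i)\<^sup>2)"
      and \<mu>: "2 * \<nu> \<le> \<mu>" "\<mu> > 0"
    for \<Delta> :: "real^'n^'n" and p :: "'n \<Rightarrow> real" and \<mu>
  proof -
    obtain C where C: "C > 0" "\<And>T z. 0 \<le> T \<Longrightarrow> continuous_on {0..T} z \<Longrightarrow>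
        (\<And>t. 0 < t \<Longrightarrow> t < T \<Longrightarrow> (z has_vector_derivative \<Delta> *v z t) (at t)) \<Longrightarrow>
        norm (z T) \<le> C * exp (- \<mu> * T) * norm (z 0)"
      using dissipative_exponential_decay[OF p diss] by blast
    obtain v :: "real^'n \<Rightarrow> real^'n \<Rightarrow> real^'n \<Rightarrow> real^'p \<Rightarrow> real^'n" and c where c: "c > 0"
      and v: "\<And>t. t \<ge> 0 \<Longrightarrow> C_k k (\<lambda>e. v (x\<^sub>d t) (u\<^sub>d t) e (w t))"
      and exact: "\<And>t e. t \<ge> 0 \<Longrightarrow> norm e \<le> c * exp (- (2 * \<nu>) * t) \<Longrightarrow>
        f (x\<^sub>d t + e) (u\<^sub>d t + v (x\<^sub>d t) (u\<^sub>d t) e (w t)) (w t) = f (x\<^sub>d t) (u\<^sub>d t) (w t) + \<Delta> *v e"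
    proof (rule exact_linearization_along_trajectory[where f = f and k = k and xd = x\<^sub>d and ud = u\<^sub>d
          and w = w and \<beta> = \<beta>\<^sub>1 and \<nu> = \<nu> and \<Delta> = \<Delta> and \<gamma>x = \<gamma>\<^sub>x and \<gamma>u = \<gamma>\<^sub>u and \<gamma>w = \<gamma>\<^sub>w,
          OF k_ge_2 f_C_k A1 _ A3_consts])
      show "rank (jacobian (\<lambda>u. f (x\<^sub>d t) u (w t)) (at (u\<^sub>d t))) = CARD('n)" if "t \<ge> 0" for t
        using A2[OF that] by (simp only: B_eq)
      show "frobenius_norm (matrix_inv (jacobian (\<lambda>u. f (x\<^sub>d t) u (w t)) (at (u\<^sub>d t)))) \<le> \<beta>\<^sub>1 * exp (\<nu> * t)"
        if "t \<ge> 0" for t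
        using A3[OF that] by (simp only: B_eq)
    qed (assumption | rule that | blast)+
    show ?thesis
    proof (intro exI conjI allI impI)
      show "c / C > 0" using c C(1) by simp
      show "exponentially_stable_within (closed_loop_solution f x\<^sub>d u\<^sub>d w v) x\<^sub>d (c / C)"
        by (rule closed_loop_exponentially_stable[OF x_d_solution C exact \<mu> c])
      show "x t - x\<^sub>d t = matrix_exp (t *\<^sub>R \<Delta>) *v (x 0 - x\<^sub>d 0)"
        if "closed_loop_solution f x\<^sub>d u\<^sub>d w v x \<and> norm (x 0 - x\<^sub>d 0) < c / C" "0 \<le> t" for x t
        using that by (intro closed_loop_error[OF x_d_solution C exact \<mu> c]) auto
    qed (rule v)
  qed
  show ?thesis
  proof (intro conjI allI impI)
    \<comment> \<open>For the pure existence claim the error matrix is \<open>- \<mu>\<close> times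
      the identity, dissipative with unit weights and equality.\<close>
    define \<mu> where "\<mu> = 2 * \<nu> + 1"
    have \<mu>: "2 * \<nu> \<le> \<mu>" "\<mu> > 0" using A3_consts(2) by (simp_all add: \<mu>_def)
    have "((- \<mu>) *\<^sub>R mat 1 *v y) $ i = - \<mu> * y $ i" for y :: "real^'n" and i
      unfolding scaleR_matrix_vector_assoc[symmetric] matrix_vector_mul_lid by simp
    then have diss: "(\<Sum>i\<in>UNIV. 1 * (y $ i * ((- \<mu>) *\<^sub>R mat 1 *v y) $ i))
        \<le> - \<mu> * (\<Sum>i\<in>UNIV. 1 * (y $ i)\<^sup>2)" for y :: "real^'n"
      by (simp add: sum_distrib_left power2_eq_square mult_ac sum_negf)
    show "\<exists>v :: real^'n \<Rightarrow> real^'n \<Rightarrow> real^'n \<Rightarrow> real^'p \<Rightarrow> real^'n.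
        (\<forall>t\<ge>0. C_k k (\<lambda>e. v (x\<^sub>d t) (u\<^sub>d t) e (w t))) \<and>
        (\<exists>\<delta>>0. exponentially_stable_within (closed_loop_solution f x\<^sub>d u\<^sub>d w v) x\<^sub>d \<delta>)"
      using main[OF zero_less_one diss \<mu>] by blast
  next
    fix \<Delta> :: "real^'n^'n"
    assume \<Delta>: "hurwitz (complex_matrix \<Delta>) \<and> semi_simple (complex_matrix \<Delta>) \<and>
      eigenvalues (complex_matrix \<Delta>) \<subseteq> \<real> \<and> jordan_canonical_form \<Delta> \<and>
      2 * max (\<nu> / \<alpha>) \<nu> + Max (Re ` eigenvalues (complex_matrix \<Delta>)) < 0"
    define m where "m = Max (Re ` eigenvalues (complex_matrix \<Delta>))"
    have "2 * max (\<nu> / \<alpha>) \<nu> + m < 0" using \<Delta> unfolding m_def by blast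
    then have "2 * \<nu> < - m" by linarith
    \<comment> \<open>The midpoint of \<open>2 * \<nu>\<close> and \<open>- m\<close>: fast enough
      for the shrinking tube, yet with a strict gap to the spectrum for absorbing the
      superdiagonal.\<close>
    define \<mu> where "\<mu> = (2 * \<nu> - m) / 2"
    have \<mu>: "2 * \<nu> \<le> \<mu>" "\<mu> > 0" "m < - \<mu>"
      using \<open>2 * \<nu> < - m\<close> A3_consts(2) by (auto simp: \<mu>_def field_simps)
    obtain p :: "'n \<Rightarrow> real" where p: "\<And>i. p i > 0"
      "\<And>y. (\<Sum>i\<in>UNIV. p i * (y $ i * (\<Delta> *v y) $ i)) \<le> - \<mu> * (\<Sum>i\<in>UNIV. p i * (y $ i)\<^sup>2)"
      using jordan_canonical_form_dissipative[of \<Delta> \<mu>] \<Delta> \<mu>(3) unfolding m_def by blast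
    show "\<exists>v :: real^'n \<Rightarrow> real^'n \<Rightarrow> real^'n \<Rightarrow> real^'p \<Rightarrow> real^'n.
        (\<forall>t\<ge>0. C_k k (\<lambda>e. v (x\<^sub>d t) (u\<^sub>d t) e (w t))) \<and>
        (\<exists>\<delta>>0. exponentially_stable_within (closed_loop_solution f x\<^sub>d u\<^sub>d w v) x\<^sub>d \<delta> \<and>
          (\<forall>x. closed_loop_solution f x\<^sub>d u\<^sub>d w v x \<and> norm (x 0 - x\<^sub>d 0) < \<delta> \<longrightarrow>
            (\<forall>t\<ge>0. x t - x\<^sub>d t = matrix_exp (t *\<^sub>R \<Delta>) *v (x 0 - x\<^sub>d 0))))"
      by (rule main[OF p \<mu>(1,2)])
  qed
qed

end
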